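(* Let $G$ be a finite star graph with vertex set $\{1,\ldots,m\}$, $m\ge 3$, in which $m$ is the vertex of highest degree (so the edges are $\{i,m\}$, $1\le i\le m-1$). Let $\alpha>0$ and let $x(n)=(x_1(n),\ldots,x_m(n))$, $n\ge 0$, be the proportions of balls in the generalized Pólya urn process on $G$ with parameter $\alpha$ (defined in the context), for arbitrary initial numbers of balls $B_i(0)\ge 1$. (a) If $\alpha\le 1$, then almost surely $x(n)$ converges, as $n\to\infty$, to $$\left(\frac{1}{m-1+(m-1)^{\frac{1}{1-\alpha}}},\ldots,\frac{1}{m-1+(m-1)^{\frac{1}{1-\alpha}}},\frac{(m-1)^{\frac{1}{1-\alpha}}}{m-1+(m-1)^{\frac{1}{1-\alpha}}}\right),$$ where for $\alpha=1$ this point is interpreted as $(0,\ldots,0,1)$. (b) If $\alpha>1$, then with positive probability $x(n)$ converges to $(0,\ldots,0,1)$, and with positive probability $x(n)$ converges to $\left(\frac{1}{m-1},\ldots,\frac{1}{m-1},0\right)$.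
   Context: The star graph is the tree with $m$ vertices and $m-1$ leaves. Generalized Pólya urn process on a finite connected graph $G=(V,E)$, $V=\{1,\ldots,m\}$, $|E|=N$, with parameter $\alpha>0$: each vertex $i$ carries a bin, initially with an integer number $B_i(0)\ge 1$ of balls. Let $\mathcal F_n$ be the sigma-algebra generated by the process up to step $n$. At step $n+1$, for each edge $\{i,j\}\in E$ exactly one ball is added, either to $i$ or to $j$; conditionally on $\mathcal F_n$, the ball is added to $i$ with probability $\frac{B_i(n)^\alpha}{B_i(n)^\alpha+B_j(n)^\alpha}$ (and to $j$ otherwise), and the choices for distinct edges are independent. $B_i(n)$ is the number of balls at vertex $i$ after step $n$. With $N_0=\sum_{i=1}^m B_i(0)$, the proportion of balls at $i$ after step $n$ is $x_i(n)=\frac{B_i(n)}{N_0+nN}$. *)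

theory Defs
  imports "HOL-Probability.Probability"
begin

text \<open>A finite connected simple graph, given by its vertex set and its set of edges, an edge being
  a two-element set of vertices.\<close>

locale finite_connected_graph =
  fixes V :: "'v set" and E :: "'v set set"
  assumes finite_V: "finite V"
    and V_nonempty: "V \<noteq> {}"
    and edges: "\<And>e. e \<in> E \<Longrightarrow> e \<subseteq> V \<and> card e = 2"
    and connected: "\<And>u v. u \<in> V \<Longrightarrow> v \<in> V \<Longrightarrow> (u, v) \<in> {(i, j). {i, j} \<in> E}\<^sup>*"

definition star_edges :: "nat \<Rightarrow> nat set set" where
  "star_edges m = {{i, m} | i. i \<in> {1..m-1}}"

text \<open>The random vertex \<open>C n e\<close> is the endpoint of the edge \<open>e\<close> that receives the ball
  thrown for \<open>e\<close> at step \<open>n + 1\<close>; \<open>b i\<close> is the initial number of balls at \<open>i\<close>.\<close>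

primrec balls ::
  "'v set set \<Rightarrow> ('v \<Rightarrow> nat) \<Rightarrow> (nat \<Rightarrow> 'v set \<Rightarrow> 'w \<Rightarrow> 'v) \<Rightarrow> nat \<Rightarrow> 'v \<Rightarrow> 'w \<Rightarrow> nat" where
  "balls E b C 0 i \<omega> = b i"
| "balls E b C (Suc n) i \<omega> = balls E b C n i \<omega> + card {e \<in> E. C n e \<omega> = i}"

definition proportion ::
  "'v set \<Rightarrow> 'v set set \<Rightarrow> ('v \<Rightarrow> nat) \<Rightarrow> (nat \<Rightarrow> 'v set \<Rightarrow> 'w \<Rightarrow> 'v) \<Rightarrow> nat \<Rightarrow> 'v \<Rightarrow> 'w \<Rightarrow> real" where
  "proportion V E b C n i \<omega> =
     real (balls E b C n i \<omega>) / (real (\<Sum>j\<in>V. b j) + real n * real (card E))"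

text \<open>The sigma-algebra generated by the process up to step \<open>n\<close>. The initial configuration is
  deterministic, so it is generated by the placements made in the steps \<open>1, \<dots>, n\<close>.\<close>

definition history ::
  "'w measure \<Rightarrow> 'v set set \<Rightarrow> (nat \<Rightarrow> 'v set \<Rightarrow> 'w \<Rightarrow> 'v) \<Rightarrow> nat \<Rightarrow> 'w measure" where
  "history M E C n = sigma (space M) {C k e -` A \<inter> space M | k e A. k < n \<and> e \<in> E}"

abbreviation cond_prob_history ::
  "'w measure \<Rightarrow> 'v set set \<Rightarrow> (nat \<Rightarrow> 'v set \<Rightarrow> 'w \<Rightarrow> 'v) \<Rightarrow> nat \<Rightarrow> 'w set \<Rightarrow> 'w \<Rightarrow> real" where
  "cond_prob_history M E C n A \<equiv> real_cond_exp M (history M E C n) (indicat_real A)"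

text \<open>In the locale below, \<open>choice_measurable\<close> says that \<open>C n e\<close> is a random variable and also
  that \<open>C n e \<omega> \<in> e\<close> for all \<open>\<omega> \<in> space M\<close>: each edge gives one ball to one of its endpoints.\<close>

locale polya_urn = finite_connected_graph V E + prob_space M
  for M :: "'w measure" and V :: "'v set" and E :: "'v set set" +
  fixes \<alpha> :: real and b :: "'v \<Rightarrow> nat" and C :: "nat \<Rightarrow> 'v set \<Rightarrow> 'w \<Rightarrow> 'v"
  assumes alpha_pos: "\<alpha> > 0"
    and initial: "\<And>i. i \<in> V \<Longrightarrow> b i \<ge> 1"
    and choice_measurable: "\<And>n e. e \<in> E \<Longrightarrow> C n e \<in> M \<rightarrow>\<^sub>M count_space e"
    and choice_prob: "\<And>n i j. {i, j} \<in> E \<Longrightarrow>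
      AE \<omega> in M. cond_prob_history M E C n {\<omega> \<in> space M. C n {i, j} \<omega> = i} \<omega> =
        real (balls E b C n i \<omega>) powr \<alpha> /
          (real (balls E b C n i \<omega>) powr \<alpha> + real (balls E b C n j \<omega>) powr \<alpha>)"
    and choice_indep: "\<And>n J s. J \<subseteq> E \<Longrightarrow>
      AE \<omega> in M. cond_prob_history M E C n {\<omega> \<in> space M. \<forall>e\<in>J. C n e \<omega> = s e} \<omega> =
        (\<Prod>e\<in>J. cond_prob_history M E C n {\<omega> \<in> space M. C n e \<omega> = s e} \<omega>)"

definition star_limit :: "nat \<Rightarrow> real \<Rightarrow> nat \<Rightarrow> real" where
  "star_limit m \<alpha> i =
     (if \<alpha> = 1 then (if i = m then 1 else 0)
      else (if i = m then (real m - 1) powr (1 / (1 - \<alpha>)) else 1) /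
        (real m - 1 + (real m - 1) powr (1 / (1 - \<alpha>))))"

lemma star_finite_connected_graph:
  assumes "m \<ge> 2"
  shows "finite_connected_graph {1..m} (star_edges m)"
proof
  let ?R = "{(i, j). {i, j} \<in> star_edges m}"
  have *: "(u, m) \<in> ?R\<^sup>* \<and> (m, u) \<in> ?R\<^sup>*" if "u \<in> {1..m}" for u
  proof (cases "u = m")
    case False
    then have "{u, m} \<in> star_edges m" using that by (auto simp: star_edges_def)
    moreover from this have "{m, u} \<in> star_edges m" by (simp add: insert_commute)
    ultimately show ?thesis by (simp add: r_into_rtrancl)
  qed simp
  show "(u, v) \<in> ?R\<^sup>*" if "u \<in> {1..m}" "v \<in> {1..m}" for u v
    using *[OF that(1)] *[OF that(2)] by (meson rtrancl_trans)
  show "e \<subseteq> {1..m} \<and> card e = 2" if "e \<in> star_edges m" for e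
    using that assms by (auto simp: star_edges_def card_insert_if)
qed (use assms in auto)

end

theory Submission
  imports Defs
begin

text \<open>For a vertex \<open>v\<close> with \<open>B\<^sub>v(n)\<close> balls, the centred placements divided by \<open>B\<^sub>v(n)\<close> are martingale
  differences whose variances are summable, because a ball added to \<open>v\<close> at step \<open>n + 1\<close> makes
  \<open>1 / B\<^sub>v\<close> telescope. Hence almost surely \<open>ln x\<^sub>v(n)\<close> differs from its accumulated drift by a
  convergent sequence. Since the noise is small on the logarithmic scale, it cannot compensate a
  positive drift near the boundary, so for \<open>\<alpha> \<le> 1\<close> a deterministic comparison remains. On the star, each leaf feels the
  other leaves only through the hub, and the stationary leaf value decreases with the hub, which
  pins down the lower and upper limits of the hub proportion.

  For \<open>\<alpha> > 1\<close>, all balls go to one side of the bipartition forever with positive probability, as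
  the conditional probabilities of the opposite choice are at most of order \<open>n\<^sup>-\<^sup>\<alpha>\<close>.\<close>

section \<open>Square-summable martingale differences\<close>

text \<open>A leaf of proportion \<open>u\<close> facing a hub of proportion \<open>v\<close> has
  logarithmic drift proportional to \<open>1 / load \<alpha> u v - k\<close>, with \<open>k\<close>
  the number of leaves. For \<alpha> \<le> 1 the load increases in both arguments, so a one-sided
  asymptotic bound on the hub gives the opposite bound on every leaf, and since the proportions sum
  to 1 this returns a bound on the hub. A hub bound \<open>s\<close> that cannot be improved in this
  way must solve \<open>load \<alpha> ((1 - s) / k) s = 1 / k\<close>. The obstacle is that
  \<open>s = 0\<close>, an empty hub with all leaves at \<open>1 / k\<close>, solves it too. The
  drift of the hub itself rules this out when \<alpha> < 1. For \<alpha> = 1 the limiting leaves are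
  empty, and the hub drift alone drives the hub to 1.\<close>

lemma (in finite_measure) integrable_real_bounded:
  assumes "f \<in> borel_measurable M" "\<And>\<omega>. \<omega> \<in> space M \<Longrightarrow> \<bar>f \<omega>\<bar> \<le> B"
  shows "integrable M (f :: _ \<Rightarrow> real)"
  using assms by (intro integrable_const_bound[of _ B]) auto

text \<open>\<open>orthogonal\<close> is the property that the conditional expectation of
  \<open>d n\<close> given \<open>F n\<close> vanishes, stated by testing against bounded
  \<open>F n\<close>-measurable functions. This is the form in which the second moment computation
  uses it. The index is shifted: \<open>d n\<close> is known at time \<open>n + 1\<close>.\<close>

locale bounded_martingale_differences = prob_space M for M :: "'w measure" +
  fixes F :: "nat \<Rightarrow> 'w measure" and d :: "nat \<Rightarrow> 'w \<Rightarrow> real" and K :: real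
  assumes filtration: "\<And>n. subalgebra M (F n)"
    and filtration_mono: "\<And>m n. m \<le> n \<Longrightarrow> sets (F m) \<subseteq> sets (F n)"
    and adapted: "\<And>n. d n \<in> borel_measurable (F (Suc n))"
    and bounded: "\<And>n \<omega>. \<omega> \<in> space M \<Longrightarrow> \<bar>d n \<omega>\<bar> \<le> K"
    and orthogonal: "\<And>n X B. X \<in> borel_measurable (F n) \<Longrightarrow>
      (\<And>\<omega>. \<omega> \<in> space M \<Longrightarrow> \<bar>X \<omega>\<bar> \<le> B) \<Longrightarrow> (\<integral>\<omega>. X \<omega> * d n \<omega> \<partial>M) = 0"
begin

lemma space_F: "space (F n) = space M"
  using filtration[of n] by (simp add: subalgebra_def)

lemma measurable_F_mono:
  assumes "f \<in> measurable (F m) N" "m \<le> n"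
  shows "f \<in> measurable (F n) N"
  using measurable_mono[of N N "F m" "F n"] assms filtration_mono[OF assms(2)] space_F by auto

lemma measurable_M: "f \<in> measurable (F n) N \<Longrightarrow> f \<in> measurable M N"
  using measurable_from_subalg[OF filtration] .

lemma d_measurable_F: "j < n \<Longrightarrow> d j \<in> borel_measurable (F n)"
  using measurable_F_mono[OF adapted] by (simp add: Suc_leI)

lemma d_measurable [measurable]: "d n \<in> borel_measurable M"
  using measurable_M[OF adapted] .

lemma shift: "bounded_martingale_differences M (\<lambda>n. F (n + a)) (\<lambda>n. d (n + a)) K"
proof unfold_locales
  show "sets (F (m + a)) \<subseteq> sets (F (n + a))" if "m \<le> n" for m n
    using that by (intro filtration_mono) simp
  show "d (n + a) \<in> borel_measurable (F (Suc n + a))" for n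
    using adapted[of "n + a"] by simp
qed (rule filtration bounded orthogonal; assumption)+

lemma integrable_d_square: "integrable M (\<lambda>\<omega>. (d n \<omega>)\<^sup>2)"
proof (rule integrable_real_bounded)
  show "\<bar>(d n \<omega>)\<^sup>2\<bar> \<le> K\<^sup>2" if "\<omega> \<in> space M" for \<omega>
    using power_mono[OF bounded[OF that, of n], of 2] by simp
qed simp

text \<open>Freezing the partial sums when they first leave \<open>(- \<epsilon>, \<epsilon>)\<close> keeps the increments
  orthogonal, so Chebyshev's inequality for the frozen sum controls the maximum.\<close>

lemma maximal_inequality_finite:
  assumes "\<epsilon> > 0"
  shows "prob {\<omega> \<in> space M. \<exists>l\<le>n. \<bar>\<Sum>j<l. d j \<omega>\<bar> \<ge> \<epsilon>} \<le> (\<Sum>j<n. \<integral>\<omega>. (d j \<omega>)\<^sup>2 \<partial>M) / \<epsilon>\<^sup>2"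
proof -
  \<comment> \<open>The condition ranges over partial sums up to \<open>l = j\<close>, which involve
    only \<open>d 0, ..., d (j - 1)\<close>. Hence \<open>I j\<close> is known at time
    \<open>j\<close>, before \<open>d j\<close> is revealed, and \<open>S n * I n\<close> is an
    admissible test function for \<open>d n\<close>.\<close>
  define I where "I j \<omega> = (if \<forall>l\<le>j. \<bar>\<Sum>i<l. d i \<omega>\<bar> < \<epsilon> then 1 else 0 :: real)" for j \<omega>
  define S where "S n \<omega> = (\<Sum>j<n. I j \<omega> * d j \<omega>)" for n \<omega>
  have I_meas: "I j \<in> borel_measurable (F j)" for j
  proof -
    have [measurable]: "(\<lambda>\<omega>. \<Sum>i<l. d i \<omega>) \<in> borel_measurable (F j)" if "l \<le> j" for l
      using that by (intro borel_measurable_sum d_measurable_F) auto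
    show ?thesis unfolding I_def by measurable
  qed
  have S_meas: "S n \<in> borel_measurable (F n)" for n
    unfolding S_def
    by (intro borel_measurable_sum borel_measurable_times d_measurable_F measurable_F_mono[OF I_meas]) auto
  have Id: "\<bar>I j \<omega> * d j \<omega>\<bar> \<le> K" if "\<omega> \<in> space M" for j \<omega>
    using bounded[OF that, of j] by (auto simp: I_def)
  have S_bound: "\<bar>S n \<omega>\<bar> \<le> real n * K" if "\<omega> \<in> space M" for n \<omega>
    unfolding S_def using sum_norm_le[of "{..<n}" "\<lambda>j. I j \<omega> * d j \<omega>" "\<lambda>_. K"] Id[OF that] by simp
  have S_int: "integrable M (\<lambda>\<omega>. (S n \<omega>)\<^sup>2)" for n
  proof (rule integrable_real_bounded)
    show "\<bar>(S n \<omega>)\<^sup>2\<bar> \<le> (real n * K)\<^sup>2" if "\<omega> \<in> space M" for \<omega>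
      using power_mono[OF S_bound[OF that, of n], of 2] by simp
  qed (use measurable_M[OF S_meas] in measurable)
  have second_moment: "(\<integral>\<omega>. (S n \<omega>)\<^sup>2 \<partial>M) \<le> (\<Sum>j<n. \<integral>\<omega>. (d j \<omega>)\<^sup>2 \<partial>M)" for n
  proof (induction n)
    case 0
    then show ?case by (simp add: S_def)
  next
    case (Suc n)
    note [measurable] = measurable_M[OF I_meas] measurable_M[OF S_meas]
    have SI: "\<bar>S n \<omega> * I n \<omega>\<bar> \<le> real n * K" if "\<omega> \<in> space M" for \<omega>
      using S_bound[OF that, of n] by (auto simp: I_def)
    have orth: "(\<integral>\<omega>. (S n \<omega> * I n \<omega>) * d n \<omega> \<partial>M) = 0"
      by (rule orthogonal[OF _ SI]) (use S_meas I_meas in measurable)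
    have int2: "integrable M (\<lambda>\<omega>. (S n \<omega> * I n \<omega>) * d n \<omega>)"
    proof (rule integrable_real_bounded)
      show "\<bar>S n \<omega> * I n \<omega> * d n \<omega>\<bar> \<le> (real n * K) * K" if "\<omega> \<in> space M" for \<omega>
        unfolding abs_mult[of _ "d n \<omega>"] using SI[OF that] bounded[OF that, of n]
        by (intro mult_mono) auto
    qed measurable
    have int3: "integrable M (\<lambda>\<omega>. (I n \<omega> * d n \<omega>)\<^sup>2)"
    proof (rule integrable_real_bounded)
      show "\<bar>(I n \<omega> * d n \<omega>)\<^sup>2\<bar> \<le> K\<^sup>2" if "\<omega> \<in> space M" for \<omega>
        using power_mono[OF Id[OF that, of n], of 2] by simp
    qed measurable
    have "(S (Suc n) \<omega>)\<^sup>2 = (S n \<omega>)\<^sup>2 + (2 * ((S n \<omega> * I n \<omega>) * d n \<omega>) + (I n \<omega> * d n \<omega>)\<^sup>2)" for \<omega>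
      by (simp add: S_def power2_eq_square algebra_simps)
    then have "(\<integral>\<omega>. (S (Suc n) \<omega>)\<^sup>2 \<partial>M) = (\<integral>\<omega>. (S n \<omega>)\<^sup>2 \<partial>M) + (\<integral>\<omega>. (I n \<omega> * d n \<omega>)\<^sup>2 \<partial>M)"
      using S_int int2 int3 orth by simp
    moreover have "(\<integral>\<omega>. (I n \<omega> * d n \<omega>)\<^sup>2 \<partial>M) \<le> (\<integral>\<omega>. (d n \<omega>)\<^sup>2 \<partial>M)"
      by (intro integral_mono int3 integrable_d_square) (auto simp: I_def)
    ultimately show ?case using Suc by simp
  qed
  have "{\<omega> \<in> space M. \<exists>l\<le>n. \<bar>\<Sum>j<l. d j \<omega>\<bar> \<ge> \<epsilon>} \<subseteq> {\<omega> \<in> space M. (S n \<omega>)\<^sup>2 \<ge> \<epsilon>\<^sup>2}"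
  proof safe
    fix \<omega> l assume w: "\<omega> \<in> space M" "l \<le> n" "\<bar>\<Sum>j<l. d j \<omega>\<bar> \<ge> \<epsilon>"
    define k where "k = (LEAST l. \<bar>\<Sum>j<l. d j \<omega>\<bar> \<ge> \<epsilon>)"
    have k: "\<bar>\<Sum>j<k. d j \<omega>\<bar> \<ge> \<epsilon>"
      unfolding k_def by (rule LeastI) (rule w(3))
    have "k \<le> l"
      unfolding k_def by (rule Least_le) (rule w(3))
    then have "k \<le> n" using w(2) by simp
    have before: "\<bar>\<Sum>j<l. d j \<omega>\<bar> < \<epsilon>" if "l < k" for l
      using not_less_Least[OF that[unfolded k_def]] by simp
    have "I j \<omega> = (if j < k then 1 else 0)" for j
    proof (cases "j < k")
      case True
      then show ?thesis using before by (simp add: I_def)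
    next
      case False
      then have "\<not> (\<forall>l\<le>j. \<bar>\<Sum>i<l. d i \<omega>\<bar> < \<epsilon>)" using k by (metis not_less)
      then show ?thesis using False unfolding I_def by simp
    qed
    then have "S n \<omega> = (\<Sum>j<n. if j < k then d j \<omega> else 0)"
      unfolding S_def by (intro sum.cong) auto
    also have "\<dots> = (\<Sum>j<k. d j \<omega>)"
      using \<open>k \<le> n\<close> by (intro sum.mono_neutral_cong_right) auto
    finally show "\<epsilon>\<^sup>2 \<le> (S n \<omega>)\<^sup>2"
      using k assms by (simp add: abs_le_square_iff[symmetric])
  qed
  moreover have "{\<omega> \<in> space M. (S n \<omega>)\<^sup>2 \<ge> \<epsilon>\<^sup>2} \<in> events"
    using measurable_M[OF S_meas] by measurable
  ultimately have "prob {\<omega> \<in> space M. \<exists>l\<le>n. \<bar>\<Sum>j<l. d j \<omega>\<bar> \<ge> \<epsilon>} \<le> prob {\<omega> \<in> space M. (S n \<omega>)\<^sup>2 \<ge> \<epsilon>\<^sup>2}"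
    by (rule finite_measure_mono)
  also have "\<dots> \<le> (\<integral>\<omega>. (S n \<omega>)\<^sup>2 \<partial>M) / \<epsilon>\<^sup>2"
    using S_int assms by (intro integral_Markov_inequality_measure[where A = "{}"]) auto
  also have "\<dots> \<le> (\<Sum>j<n. \<integral>\<omega>. (d j \<omega>)\<^sup>2 \<partial>M) / \<epsilon>\<^sup>2"
    using second_moment by (intro divide_right_mono) auto
  finally show ?thesis .
qed

lemma maximal_inequality:
  assumes "\<epsilon> > 0" and sm: "summable (\<lambda>n. \<integral>\<omega>. (d n \<omega>)\<^sup>2 \<partial>M)"
  shows "prob {\<omega> \<in> space M. \<exists>l. \<bar>\<Sum>j<l. d j \<omega>\<bar> \<ge> \<epsilon>} \<le> (\<Sum>j. \<integral>\<omega>. (d j \<omega>)\<^sup>2 \<partial>M) / \<epsilon>\<^sup>2"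
proof -
  let ?A = "\<lambda>n. {\<omega> \<in> space M. \<exists>l\<le>n. \<bar>\<Sum>j<l. d j \<omega>\<bar> \<ge> \<epsilon>}"
  have "(\<lambda>n. prob (?A n)) \<longlonglongrightarrow> prob (\<Union>n. ?A n)"
    by (rule finite_Lim_measure_incseq)
       (auto simp: incseq_def intro: order_trans)
  moreover have "(\<Union>n. ?A n) = {\<omega> \<in> space M. \<exists>l. \<bar>\<Sum>j<l. d j \<omega>\<bar> \<ge> \<epsilon>}"
    by auto
  moreover have le: "prob (?A n) \<le> (\<Sum>j. \<integral>\<omega>. (d j \<omega>)\<^sup>2 \<partial>M) / \<epsilon>\<^sup>2" for n
    using maximal_inequality_finite[OF assms(1), of n]
      divide_right_mono[OF sum_le_suminf[OF sm, of "{..<n}"], of "\<epsilon>\<^sup>2"] by simp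
  ultimately show ?thesis
    using le by (intro LIMSEQ_le_const2[of "\<lambda>n. prob (?A n)"]) auto
qed

text \<open>The maximal inequality is applied to the tails. The event that every tail oscillates by
  at least \<epsilon> lies in the event for the tail from \<open>a\<close>, whose probability is at
  most the remaining variance over the square of \<epsilon>. Letting \<open>a\<close> grow makes it
  null, and the countably many values \<open>1 / Suc q\<close> of \<epsilon> give the Cauchy
  criterion.\<close>

theorem AE_summable:
  assumes sm: "summable (\<lambda>n. \<integral>\<omega>. (d n \<omega>)\<^sup>2 \<partial>M)"
  shows "AE \<omega> in M. summable (\<lambda>n. d n \<omega>)"
proof -
  have "AE \<omega> in M. \<exists>a. \<forall>l. \<bar>\<Sum>j<l. d (j + a) \<omega>\<bar> < \<epsilon>" if \<epsilon>: "\<epsilon> > 0" for \<epsilon>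
  proof -
    let ?B = "\<lambda>a. {\<omega> \<in> space M. \<exists>l. \<bar>\<Sum>j<l. d (j + a) \<omega>\<bar> \<ge> \<epsilon>}"
    let ?t = "\<lambda>a. (\<Sum>j. \<integral>\<omega>. (d (j + a) \<omega>)\<^sup>2 \<partial>M)"
    have le: "prob (\<Inter>a. ?B a) \<le> ?t a / \<epsilon>\<^sup>2" for a
    proof -
      interpret s: bounded_martingale_differences M "\<lambda>n. F (n + a)" "\<lambda>n. d (n + a)" K
        by (rule shift)
      have "prob (\<Inter>a. ?B a) \<le> prob (?B a)"
        by (intro finite_measure_mono) auto
      also have "\<dots> \<le> ?t a / \<epsilon>\<^sup>2"
        using sm by (intro s.maximal_inequality \<epsilon>) (subst summable_iff_shift)
      finally show ?thesis .
    qed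
    have "(\<lambda>a. ?t a / \<epsilon>\<^sup>2) \<longlonglongrightarrow> 0 / \<epsilon>\<^sup>2"
      using suminf_exist_split2[OF sm] by (intro tendsto_divide) (use \<epsilon> in auto)
    then have "prob (\<Inter>a. ?B a) \<le> 0 / \<epsilon>\<^sup>2"
      by (rule LIMSEQ_le_const) (use le in auto)
    then have "prob (\<Inter>a. ?B a) = 0"
      by (simp add: measure_le_0_iff)
    moreover have "(\<Inter>a. ?B a) \<in> events" by measurable
    ultimately have "(\<Inter>a. ?B a) \<in> null_sets M"
      by (simp add: emeasure_eq_measure null_setsI)
    then show ?thesis
      by (rule AE_I') (auto simp: not_less)
  qed
  then have "AE \<omega> in M. \<forall>q::nat. \<exists>a. \<forall>l. \<bar>\<Sum>j<l. d (j + a) \<omega>\<bar> < 1 / real (Suc q)"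
    by (subst AE_all_countable) simp
  then show ?thesis
  proof (rule AE_mp, intro AE_I2 impI)
    fix \<omega> assume *: "\<forall>q::nat. \<exists>a. \<forall>l. \<bar>\<Sum>j<l. d (j + a) \<omega>\<bar> < 1 / real (Suc q)"
    show "summable (\<lambda>n. d n \<omega>)"
      unfolding summable_Cauchy
    proof (intro allI impI)
      fix e :: real assume "e > 0"
      then obtain q where q: "1 / real (Suc q) < e / 2"
        using nat_approx_posE[of "e / 2"] by auto
      obtain a where a: "\<And>l. \<bar>\<Sum>j<l. d (j + a) \<omega>\<bar> < 1 / real (Suc q)" using * by blast
      have eq: "(\<Sum>j<l - a. d (j + a) \<omega>) = sum (\<lambda>n. d n \<omega>) {a..<l}" for l
        using sum.shift_bounds_nat_ivl[of "\<lambda>n. d n \<omega>" 0 a "l - a"]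
        by (cases "a \<le> l") (auto simp: lessThan_atLeast0)
      have "norm (sum (\<lambda>n. d n \<omega>) {m..<n}) < e" if "m \<ge> a" for m n
      proof (cases "m \<le> n")
        case True
        have "sum (\<lambda>n. d n \<omega>) {m..<n} = sum (\<lambda>n. d n \<omega>) {a..<n} - sum (\<lambda>n. d n \<omega>) {a..<m}"
          using sum_diff_nat_ivl[of a m n "\<lambda>n. d n \<omega>"] True that by simp
        then show ?thesis
          using a[of "m - a"] a[of "n - a"] q unfolding eq by simp
      qed (use \<open>e > 0\<close> in simp)
      then show "\<exists>N. \<forall>m\<ge>N. \<forall>n. norm (sum (\<lambda>n. d n \<omega>) {m..<n}) < e" by blast
    qed
  qed
qed

end

section \<open>Sequences with logarithmic drift\<close>

text \<open>No upper bound on \<open>x\<close> is imposed because a relative increment may exceed 1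
  while a bin holds few balls. For \<open>x > 1\<close> both \<open>ln (1 + x)\<close> and
  \<open>x\<close> lie between 0 and \<open>x\<close>, and \<open>x\<close> is below its
  square.\<close>

lemma abs_ln_one_plus_minus_le:
  fixes x :: real
  assumes "0 \<le> x"
  shows "\<bar>ln (1 + x) - x\<bar> \<le> x\<^sup>2"
proof (cases "x \<le> 1")
  case True
  then show ?thesis using abs_ln_one_plus_x_minus_x_bound_nonneg[OF assms] by simp
next
  case False
  then have "x \<le> x\<^sup>2" by (simp add: power2_eq_square)
  moreover have "ln (1 + x) \<le> x" "0 \<le> ln (1 + x)"
    using assms ln_add_one_self_le_self[of x] by auto
  ultimately show ?thesis by simp
qed

text \<open>An increase is by at least one, so \<open>1 / b^2\<close> is at most
  \<open>2 / (b * (b + 1)) = 2 / b - 2 / (b + 1)\<close>, and this is at most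
  \<open>2 / b - 2 / b'\<close>. The sum telescopes to a bound that does not depend on how fast
  \<open>B\<close> grows.\<close>

lemma sum_increase_inverse_square_le:
  fixes B :: "nat \<Rightarrow> nat"
  assumes "B 0 > 0" and mono: "\<And>n. B n \<le> B (Suc n)"
  shows "(\<Sum>j<n. (if B j < B (Suc j) then 1 else 0) / (real (B j))\<^sup>2) \<le> 2"
proof -
  have pos: "B n > 0" for n
    using assms(1) lift_Suc_mono_le[of B 0 n] mono by (meson order_less_le_trans zero_le)
  have step: "1 / (real b)\<^sup>2 \<le> 2 / real b - 2 / real b'" if "b > 0" "b < b'" for b b' :: nat
  proof -
    have "2 / real b' \<le> 2 / (real b + 1)"
      using that by (intro divide_left_mono) auto
    moreover have "1 / (real b)\<^sup>2 \<le> 2 / real b - 2 / (real b + 1)"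
    proof -
      have "2 / real b - 2 / (real b + 1) = 2 / (real b * (real b + 1))"
        using that by (simp add: field_simps)
      also have "\<dots> \<ge> 2 / (real b * (2 * real b))"
        using that by (intro divide_left_mono mult_left_mono) auto
      finally show ?thesis using that by (simp add: power2_eq_square)
    qed
    ultimately show ?thesis by simp
  qed
  have "(\<Sum>j<n. (if B j < B (Suc j) then 1 else 0) / (real (B j))\<^sup>2) \<le> (\<Sum>j<n. 2 / real (B j) - 2 / real (B (Suc j)))"
  proof (rule sum_mono)
    fix j
    show "(if B j < B (Suc j) then 1 else 0) / (real (B j))\<^sup>2 \<le> 2 / real (B j) - 2 / real (B (Suc j))"
      using step[OF pos, of j "B (Suc j)"] mono[of j] by (cases "B j < B (Suc j)") auto
  qed
  also have "\<dots> = 2 / real (B 0) - 2 / real (B n)"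
    by (induction n) auto
  also have "\<dots> \<le> 2"
  proof -
    have "2 / real (B 0) \<le> 2" using pos[of 0] by (simp add: divide_le_eq)
    moreover have "2 / real (B n) \<ge> 0" by simp
    ultimately show ?thesis by linarith
  qed
  finally show ?thesis .
qed

text \<open>Replacing \<open>ln (1 + u)\<close> by the relative increment \<open>u\<close> costs at
  most \<open>u^2\<close>. This vanishes unless \<open>B\<close> increases and is then at most
  \<open>K^2 / B^2\<close>, so the preceding lemma makes the errors summable.\<close>

lemma convergent_ln_minus_relative_increments:
  fixes B :: "nat \<Rightarrow> nat"
  assumes "B 0 > 0" and mono: "\<And>n. B n \<le> B (Suc n)" and bnd: "\<And>n. B (Suc n) \<le> B n + K"
  shows "convergent (\<lambda>n. ln (real (B n)) - (\<Sum>j<n. (real (B (Suc j)) - real (B j)) / real (B j)))"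
proof -
  have pos: "B n > 0" for n
    using assms(1) lift_Suc_mono_le[of B 0 n] mono by (meson order_less_le_trans zero_le)
  define t where "t j = ln (real (B (Suc j))) - ln (real (B j)) - (real (B (Suc j)) - real (B j)) / real (B j)" for j
  let ?s = "\<lambda>j. (if B j < B (Suc j) then 1 else 0) / (real (B j))\<^sup>2"
  have "summable ?s"
    by (rule bounded_imp_summable[of _ 2])
       (use sum_increase_inverse_square_le[OF assms(1,2), of "Suc _"] in \<open>auto simp: lessThan_Suc_atMost\<close>)
  then have "summable (\<lambda>j. (real K)\<^sup>2 * ?s j)" by (rule summable_mult)
  moreover have "norm (t j) \<le> (real K)\<^sup>2 * ?s j" for j
  proof -
    let ?u = "(real (B (Suc j)) - real (B j)) / real (B j)"
    have u: "0 \<le> ?u" using mono[of j] by simp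
    have "real (B (Suc j)) = real (B j) * (1 + ?u)" using pos[of j] by (simp add: field_simps)
    then have "ln (real (B (Suc j))) = ln (real (B j)) + ln (1 + ?u)"
      using pos[of j] u by (metis ln_mult_pos of_nat_0_less_iff add_pos_nonneg zero_less_one)
    then have "norm (t j) = \<bar>ln (1 + ?u) - ?u\<bar>" by (simp add: t_def)
    also have "\<dots> \<le> ?u\<^sup>2" by (rule abs_ln_one_plus_minus_le[OF u])
    also have "\<dots> \<le> (real K)\<^sup>2 * ?s j"
    proof (cases "B j < B (Suc j)")
      case True
      have "(real (B (Suc j)) - real (B j))\<^sup>2 \<le> (real K)\<^sup>2"
        using mono[of j] bnd[of j] by (intro power_mono) auto
      then show ?thesis using True pos[of j] by (simp add: power_divide divide_right_mono)
    qed (use mono[of j] in simp)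
    finally show ?thesis .
  qed
  ultimately have "summable t" by (rule summable_comparison_test'[where N = 0])
  then have "convergent (\<lambda>n. \<Sum>j<n. t j)" by (simp add: summable_iff_convergent)
  then have "convergent (\<lambda>n. ln (real (B 0)) + (\<Sum>j<n. t j))"
    by (intro convergent_add convergent_const)
  moreover have "ln (real (B 0)) + (\<Sum>j<n. t j) =
      ln (real (B n)) - (\<Sum>j<n. (real (B (Suc j)) - real (B j)) / real (B j))" for n
    by (induction n) (auto simp: t_def)
  ultimately show ?thesis by simp
qed

text \<open>Up to a convergent sequence, \<open>w\<close> is the sum of its drift. It cannot stay
  above \<open>t\<close> forever, since the divergent sum of \<open>a\<close> would push it to minus
  infinity. Afterwards an excursion above \<open>t\<close> starts with a small jump, and the drift
  only lowers it, so it gains no more than the oscillation of the convergent part.\<close>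

lemma eventually_less_of_negative_drift:
  fixes w a g :: "nat \<Rightarrow> real"
  assumes conv: "convergent (\<lambda>n. w n - (\<Sum>j<n. a j * g j))"
    and a: "\<And>n. a n \<ge> 0" "\<not> summable a"
    and "\<kappa> > 0" and drift: "\<forall>\<^sub>F n in sequentially. t \<le> w n \<longrightarrow> g n \<le> - \<kappa>"
    and jump: "\<And>e. e > 0 \<Longrightarrow> \<forall>\<^sub>F n in sequentially. w n < t \<longrightarrow> w (Suc n) < t + e"
    and "e > 0"
  shows "\<forall>\<^sub>F n in sequentially. w n < t + e"
proof -
  define c where "c n = w n - (\<Sum>j<n. a j * g j)" for n
  \<comment> \<open>One half of \<open>e\<close> pays for the jump across \<open>t\<close>, the
    other for the oscillation of \<open>c\<close>.\<close>
  define \<epsilon> where "\<epsilon> = e / 2"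
  have \<epsilon>: "\<epsilon> > 0" using \<open>e > 0\<close> by (simp add: \<epsilon>_def)
  have "Cauchy c" using conv unfolding c_def by (rule convergent_Cauchy)
  then obtain N1 where N1: "\<And>m n. m \<ge> N1 \<Longrightarrow> n \<ge> N1 \<Longrightarrow> \<bar>c m - c n\<bar> < \<epsilon>"
    using \<epsilon> unfolding Cauchy_def dist_real_def by metis
  obtain N2 where N2: "\<And>n. n \<ge> N2 \<Longrightarrow> t \<le> w n \<Longrightarrow> g n \<le> - \<kappa>"
    using drift unfolding eventually_sequentially by blast
  obtain N3 where N3: "\<And>n. n \<ge> N3 \<Longrightarrow> w n < t \<Longrightarrow> w (Suc n) < t + \<epsilon>"
    using jump[OF \<epsilon>] unfolding eventually_sequentially by blast
  define N where "N = max N1 (max N2 N3)"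
  have excursion: "w n \<le> w m + \<epsilon> - \<kappa> * (\<Sum>j=m..<n. a j)"
    if "N \<le> m" "m \<le> n" "\<And>j. m \<le> j \<Longrightarrow> j < n \<Longrightarrow> t \<le> w j" for m n
  proof -
    have "(\<Sum>j<n. a j * g j) - (\<Sum>j<m. a j * g j) = (\<Sum>j=m..<n. a j * g j)"
      using that(2) by (simp add: sum_diff_nat_ivl lessThan_atLeast0)
    also have "\<dots> \<le> (\<Sum>j=m..<n. a j * (- \<kappa>))"
      using that N2 a(1) by (intro sum_mono mult_left_mono) (auto simp: N_def)
    also have "\<dots> = - \<kappa> * (\<Sum>j=m..<n. a j)"
      by (simp add: sum_distrib_left mult.commute sum_negf)
    finally have "(\<Sum>j<n. a j * g j) - (\<Sum>j<m. a j * g j) \<le> - \<kappa> * (\<Sum>j=m..<n. a j)" .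
    moreover have "c n - c m < \<epsilon>" using N1[of n m] that by (auto simp: N_def)
    ultimately show ?thesis by (simp add: c_def)
  qed
  have "\<exists>n0\<ge>N. w n0 < t"
  proof (rule ccontr)
    assume "\<not> (\<exists>n0\<ge>N. w n0 < t)"
    then have above: "t \<le> w n" if "N \<le> n" for n using that by (meson not_le)
    have "(\<Sum>j=N..<n. a j) \<le> (w N + \<epsilon> - t) / \<kappa>" if "N \<le> n" for n
      using excursion[OF order_refl that] above[OF that] above \<open>\<kappa> > 0\<close> by (simp add: field_simps)
    then have *: "(\<Sum>j\<le>n. a (j + N)) \<le> (w N + \<epsilon> - t) / \<kappa>" for n
      using sum.shift_bounds_nat_ivl[of a 0 N "Suc n"]
      by (metis add.left_neutral atLeast0AtMost atLeastLessThanSuc_atLeastAtMost le_add2)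
    have "summable (\<lambda>j. a (j + N))"
      by (rule bounded_imp_summable[OF a(1) *])
    then show False using a(2) by simp
  qed
  then obtain n0 where n0: "n0 \<ge> N" "w n0 < t" by blast
  have "w n < t + e" if "n \<ge> n0" for n
  proof (cases "w n < t")
    case True
    then show ?thesis using \<open>e > 0\<close> by simp
  next
    case False
    \<comment> \<open>The last time up to \<open>n\<close> below \<open>t\<close>: the excursion
      containing \<open>n\<close> starts at \<open>Suc l\<close>.\<close>
    define l where "l = (GREATEST l. l \<le> n \<and> w l < t)"
    have l: "l \<le> n" "w l < t"
      unfolding l_def using GreatestI_nat[of "\<lambda>l. l \<le> n \<and> w l < t" n0 n] n0 that by auto
    have max: "j \<le> l" if "j \<le> n" "w j < t" for j
      unfolding l_def using Greatest_le_nat[of "\<lambda>l. l \<le> n \<and> w l < t" j n] that by auto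
    have "n0 \<le> l" using max n0 that by auto
    have "l < n" using l False by (metis le_neq_implies_less)
    have "w n \<le> w (Suc l) + \<epsilon> - \<kappa> * (\<Sum>j=Suc l..<n. a j)"
    proof (rule excursion)
      fix j assume "Suc l \<le> j" "j < n"
      then show "t \<le> w j" using max[of j] by force
    qed (use \<open>l < n\<close> \<open>n0 \<le> l\<close> n0 in auto)
    also have "\<dots> \<le> w (Suc l) + \<epsilon>"
      using \<open>\<kappa> > 0\<close> a(1) by (simp add: sum_nonneg)
    also have "\<dots> < t + e"
      using N3[OF _ l(2)] \<open>n0 \<le> l\<close> n0 by (simp add: N_def \<epsilon>_def)
    finally show ?thesis .
  qed
  then show ?thesis unfolding eventually_sequentially by blast
qed

text \<open>The previous lemma is used for \<open>ln x\<close> and for \<open>- ln x\<close>. Jumps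
  matter only when they cross the level \<open>s\<close>, and there an absolute step of size
  \<open>s * (exp e - 1)\<close> or \<open>s * (1 - exp (- e))\<close> amounts to \<open>e\<close>
  on the logarithmic scale. Thus \<open>x\<close> need not stay away from 0, where \<open>ln\<close>
  is steep.\<close>

lemma
  fixes x a g :: "nat \<Rightarrow> real"
  assumes pos: "\<And>n. x n > 0"
    and conv: "convergent (\<lambda>n. ln (x n) - (\<Sum>j<n. a j * g j))"
    and a: "\<And>n. a n \<ge> 0" "\<not> summable a"
    and step: "(\<lambda>n. x (Suc n) - x n) \<longlonglongrightarrow> 0"
    and "\<kappa> > 0" "0 < s"
  shows log_drift_upper: "s < s' \<Longrightarrow> \<forall>\<^sub>F n in sequentially. s \<le> x n \<longrightarrow> g n \<le> - \<kappa> \<Longrightarrow>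
      \<forall>\<^sub>F n in sequentially. x n < s'"
    and log_drift_lower: "s' < s \<Longrightarrow> \<forall>\<^sub>F n in sequentially. x n \<le> s \<longrightarrow> \<kappa> \<le> g n \<Longrightarrow>
      \<forall>\<^sub>F n in sequentially. s' < x n"
proof -
  assume s': "s < s'" and drift: "\<forall>\<^sub>F n in sequentially. s \<le> x n \<longrightarrow> g n \<le> - \<kappa>"
  have "\<forall>\<^sub>F n in sequentially. ln (x n) < ln s + (ln s' - ln s)"
  proof (rule eventually_less_of_negative_drift[OF conv a \<open>\<kappa> > 0\<close>])
    show "\<forall>\<^sub>F n in sequentially. ln s \<le> ln (x n) \<longrightarrow> g n \<le> - \<kappa>"
      using drift pos \<open>0 < s\<close> by simp
    show "0 < ln s' - ln s" using s' \<open>0 < s\<close> by simp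
    fix e :: real assume "e > 0"
    then have "0 < s * (exp e - 1)" using \<open>0 < s\<close> by simp
    then have "\<forall>\<^sub>F n in sequentially. x (Suc n) - x n < s * (exp e - 1)"
      using step by (intro order_tendstoD(2)) auto
    then show "\<forall>\<^sub>F n in sequentially. ln (x n) < ln s \<longrightarrow> ln (x (Suc n)) < ln s + e"
    proof eventually_elim
      case (elim n)
      show ?case
      proof
        assume "ln (x n) < ln s"
        then have "x n < s" using pos \<open>0 < s\<close> by simp
        then have "x (Suc n) < s * exp e" using elim by (simp add: algebra_simps)
        then have "ln (x (Suc n)) < ln (s * exp e)" using pos[of "Suc n"] \<open>0 < s\<close> by simp
        then show "ln (x (Suc n)) < ln s + e" using \<open>0 < s\<close> by (simp add: ln_mult)
      qed
    qed
  qed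
  then show "\<forall>\<^sub>F n in sequentially. x n < s'"
    using pos \<open>0 < s\<close> s' by (auto elim!: eventually_mono)
next
  assume s': "s' < s" and drift: "\<forall>\<^sub>F n in sequentially. x n \<le> s \<longrightarrow> \<kappa> \<le> g n"
  \<comment> \<open>The level \<open>s'\<close> may be nonpositive and have no meaningful logarithm;
    \<open>r\<close> is a positive level with \<open>s' \<le> r < s\<close>.\<close>
  define r where "r = max s' (s / 2)"
  have r: "0 < r" "r < s" "s' \<le> r" using s' \<open>0 < s\<close> by (auto simp: r_def)
  have "\<forall>\<^sub>F n in sequentially. - ln (x n) < - ln s + (ln s - ln r)"
  proof (rule eventually_less_of_negative_drift[OF _ a \<open>\<kappa> > 0\<close>, where g = "\<lambda>n. - g n"])
    have "convergent (\<lambda>n. - (ln (x n) - (\<Sum>j<n. a j * g j)))"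
      using conv by (subst (asm) convergent_minus_iff)
    moreover have "- ln (x n) - (\<Sum>j<n. a j * - g j) = - (ln (x n) - (\<Sum>j<n. a j * g j))" for n
      by (simp add: sum_negf)
    ultimately show "convergent (\<lambda>n. - ln (x n) - (\<Sum>j<n. a j * - g j))"
      by presburger
    show "\<forall>\<^sub>F n in sequentially. - ln s \<le> - ln (x n) \<longrightarrow> - g n \<le> - \<kappa>"
      using drift pos \<open>0 < s\<close> by simp
    show "0 < ln s - ln r" using r by simp
    fix e :: real assume "e > 0"
    then have "0 < s * (1 - exp (- e))" using \<open>0 < s\<close> by simp
    then have "\<forall>\<^sub>F n in sequentially. - (s * (1 - exp (- e))) < x (Suc n) - x n"
      using step by (intro order_tendstoD(1)) auto
    then show "\<forall>\<^sub>F n in sequentially. - ln (x n) < - ln s \<longrightarrow> - ln (x (Suc n)) < - ln s + e"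
    proof eventually_elim
      case (elim n)
      show ?case
      proof
        assume "- ln (x n) < - ln s"
        then have "s < x n" using pos \<open>0 < s\<close> by simp
        then have "s * exp (- e) < x (Suc n)" using elim by (simp add: algebra_simps)
        then have "ln (s * exp (- e)) < ln (x (Suc n))" using pos[of "Suc n"] \<open>0 < s\<close> by simp
        then show "- ln (x (Suc n)) < - ln s + e" using \<open>0 < s\<close> by (simp add: ln_mult)
      qed
    qed
  qed
  then show "\<forall>\<^sub>F n in sequentially. s' < x n"
  proof eventually_elim
    case (elim n)
    then have "r < x n" using r pos by simp
    then show ?case using r by simp
  qed
qed

lemma affine_sequence:
  fixes s N :: real
  assumes "0 < s" "0 < N"
  shows inverse_affine_tendsto: "(\<lambda>n. 1 / (s + real n * N)) \<longlonglongrightarrow> 0"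
    and affine_ratio_tendsto: "(\<lambda>n. (b + real n * c) / (s + real n * N)) \<longlonglongrightarrow> c / N"
    and inverse_affine_not_summable: "\<not> summable (\<lambda>n. 1 / (s + real n * N))"
proof -
  have pos: "0 < s + real n * N" for n using assms by (intro add_pos_nonneg) auto
  have "LIM n sequentially. N * real n :> at_top"
    using assms by (intro filterlim_tendsto_pos_mult_at_top[OF tendsto_const] filterlim_real_sequentially) auto
  then have "LIM n sequentially. s + real n * N :> at_top"
    by (intro filterlim_tendsto_add_at_top[OF tendsto_const]) (simp add: mult.commute)
  then show inv: "(\<lambda>n. 1 / (s + real n * N)) \<longlonglongrightarrow> 0"
    using tendsto_inverse_0_at_top by (auto simp: inverse_eq_divide)
  have "(b + real n * c) / (s + real n * N) = c / N + (b - c * s / N) * (1 / (s + real n * N))" for n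
  proof -
    have "b + real n * c = c / N * (s + real n * N) + (b - c * s / N)"
      using assms by (simp add: field_simps)
    moreover have "(c / N * T + q) / T = c / N + q * (1 / T)" if "0 < T" for T q
      using that by (simp add: add_divide_distrib)
    ultimately show ?thesis using pos[of n] by presburger
  qed
  moreover have "(\<lambda>n. c / N + (b - c * s / N) * (1 / (s + real n * N))) \<longlonglongrightarrow> c / N + (b - c * s / N) * 0"
    by (intro tendsto_intros inv)
  ultimately show "(\<lambda>n. (b + real n * c) / (s + real n * N)) \<longlonglongrightarrow> c / N" by simp
  show "\<not> summable (\<lambda>n. 1 / (s + real n * N))"
  proof
    assume "summable (\<lambda>n. 1 / (s + real n * N))"
    then have "summable (\<lambda>n. (s + N) * (1 / (s + real n * N)))" by (rule summable_mult)
    \<comment> \<open>For \<open>n \<ge> 1\<close> the affine sequence is at most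
      \<open>(s + N) * n\<close>, so the harmonic series is a minorant up to a constant.\<close>
    moreover have "norm (inverse (real n)) \<le> (s + N) * (1 / (s + real n * N))" if "1 \<le> n" for n
    proof -
      have "s * 1 \<le> s * real n" using assms that by (intro mult_left_mono) auto
      then have "s + real n * N \<le> (s + N) * real n" by (simp add: algebra_simps)
      then show ?thesis using pos[of n] that by (simp add: field_simps)
    qed
    ultimately have "summable (\<lambda>n. inverse (real n))"
      by (rule summable_comparison_test'[where N = 1])
    then show False using not_summable_harmonic by blast
  qed
qed

section \<open>Deterministic dynamics on the star\<close>

text \<open>\<open>load \<alpha> u v\<close> is \<open>u\<close> divided by the probability \<open>u\<^sup>\<alpha> / (u\<^sup>\<alpha> + v\<^sup>\<alpha>)\<close>.\<close>

definition load :: "real \<Rightarrow> real \<Rightarrow> real \<Rightarrow> real" where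
  "load \<alpha> u v = u + u powr (1 - \<alpha>) * v powr \<alpha>"

lemma load_pos: "0 < u \<Longrightarrow> 0 < load \<alpha> u v"
  by (simp add: load_def add_pos_nonneg)

lemma inverse_load:
  assumes "0 < u" "0 < v"
  shows "1 / load \<alpha> u v = u powr \<alpha> / (u powr \<alpha> + v powr \<alpha>) / u"
proof -
  define w x z where "w = u powr (1 - \<alpha>)" and "x = u powr \<alpha>" and "z = v powr \<alpha>"
  have pos: "0 < w" "0 < x" "0 < z" using assms by (auto simp: w_def x_def z_def)
  have u: "u = w * x"
    using assms by (simp add: w_def x_def powr_add[symmetric])
  have "load \<alpha> u v = w * x + w * z"
    using u by (simp add: load_def w_def z_def)
  moreover have "1 / (w * D) = x / D / (w * x)" if "0 < D" for D
    using pos that by (simp add: field_simps)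
  from this[of "x + z"] have "1 / (w * x + w * z) = x / (x + z) / (w * x)"
    using pos by (simp add: distrib_left)
  ultimately show ?thesis
    unfolding x_def[symmetric] z_def[symmetric] using u by simp
qed

text \<open>This is where \<alpha> \<le> 1 enters: both exponents \<open>1 - \<alpha>\<close> and
  \<open>\<alpha>\<close> are nonnegative. For \<alpha> > 1 and \<open>v > 0\<close> the load
  decreases in \<open>u\<close> near 0.\<close>

lemma load_mono:
  assumes "0 < \<alpha>" "\<alpha> \<le> 1" "0 \<le> u" "u \<le> u'" "0 \<le> v" "v \<le> v'"
  shows "load \<alpha> u v \<le> load \<alpha> u' v'"
  unfolding load_def using assms by (intro add_mono mult_mono powr_mono2) auto

text \<open>The limits may be 0. Strict positivity of both exponents makes the powers continuous
  there along nonnegative values. The case \<open>u = 0\<close> arises in the upper bound for the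
  hub, when its upper limit might be 1.\<close>

lemma load_tendsto:
  assumes "0 < \<alpha>" "\<alpha> < 1" "0 \<le> u" "0 \<le> v" "(f \<longlongrightarrow> u) F" "(g \<longlongrightarrow> v) F"
    "\<forall>\<^sub>F z in F. 0 \<le> f z" "\<forall>\<^sub>F z in F. 0 \<le> g z"
  shows "((\<lambda>z. load \<alpha> (f z) (g z)) \<longlongrightarrow> load \<alpha> u v) F"
  unfolding load_def using assms
  by (intro tendsto_add tendsto_mult tendsto_powr' tendsto_const) auto

text \<open>Homogeneity of degree one lets proportions replace ball counts in the drift; the factor
  that comes out becomes the step size \<open>1 / total_balls\<close>.\<close>

lemma load_scale:
  assumes "0 < c" "0 \<le> u" "0 \<le> v"
  shows "load \<alpha> (c * u) (c * v) = c * load \<alpha> u v"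
proof -
  have "c powr (1 - \<alpha>) * c powr \<alpha> = c" using assms by (simp add: powr_add[symmetric])
  then have "(c * u) powr (1 - \<alpha>) * (c * v) powr \<alpha> = c * (u powr (1 - \<alpha>) * v powr \<alpha>)"
    using assms by (simp add: powr_mult mult.assoc[symmetric] mult.commute mult.left_commute)
  then show ?thesis by (simp add: load_def algebra_simps)
qed

text \<open>This abstracts one sample path: \<open>y\<close> and \<open>h\<close> are the leaf and
  hub proportions, and \<open>a n\<close> is the reciprocal of the number of balls. The star has
  \<open>card A\<close> edges, so the total grows at relative rate \<open>card A * a n\<close>; this
  is the term subtracted in both drifts.\<close>

locale star_dynamics =
  fixes A :: "'a set" and y :: "nat \<Rightarrow> 'a \<Rightarrow> real" and h a :: "nat \<Rightarrow> real" and \<alpha> :: real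
  assumes finite_A: "finite A" and card_A: "card A \<ge> 2"
    and y_pos: "\<And>n i. i \<in> A \<Longrightarrow> 0 < y n i" and h_pos: "\<And>n. 0 < h n"
    and total: "\<And>n. (\<Sum>i\<in>A. y n i) + h n = 1"
    and a_nonneg: "\<And>n. 0 \<le> a n" and a_div: "\<not> summable a"
    and y_step: "\<And>i. i \<in> A \<Longrightarrow> (\<lambda>n. y (Suc n) i - y n i) \<longlonglongrightarrow> 0"
    and h_step: "(\<lambda>n. h (Suc n) - h n) \<longlonglongrightarrow> 0"
    and y_drift: "\<And>i. i \<in> A \<Longrightarrow> convergent (\<lambda>n. ln (y n i) -
      (\<Sum>j<n. a j * (1 / load \<alpha> (y j i) (h j) - real (card A))))"
    and h_drift: "convergent (\<lambda>n. ln (h n) -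
      (\<Sum>j<n. a j * ((\<Sum>i\<in>A. 1 / load \<alpha> (h j) (y j i)) - real (card A))))"
    and alpha: "0 < \<alpha>" "\<alpha> \<le> 1"
begin

abbreviation "k \<equiv> real (card A)"

lemma A_nonempty: "A \<noteq> {}"
  using card_A by auto

lemma y_le: "i \<in> A \<Longrightarrow> y n i \<le> 1 - h n"
  using member_le_sum[of i A "y n"] finite_A y_pos total[of n] by (auto simp: less_imp_le)

lemma h_less_1: "h n < 1"
  using A_nonempty y_le y_pos by (metis all_not_in_conv diff_gt_0_iff_gt less_le_trans)

text \<open>While the leaf is at least \<open>s\<close> and the hub exceeds \<open>b\<close>,
  monotonicity keeps the load at least \<open>load \<alpha> s b\<close>, so the drift is at most the
  negative constant \<open>1 / load \<alpha> s b - k\<close>.\<close>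

lemma leaf_upper:
  assumes "i \<in> A" "0 < s" "s < s'" "0 < b" and h: "\<forall>\<^sub>F n in sequentially. b < h n"
    and b: "1 / k < load \<alpha> s b"
  shows "\<forall>\<^sub>F n in sequentially. y n i < s'"
proof (rule log_drift_upper[OF y_pos[OF assms(1)] y_drift[OF assms(1)] a_nonneg a_div y_step[OF assms(1)]])
  have pos: "0 < load \<alpha> s b" using assms(2) by (rule load_pos)
  show "0 < k - 1 / load \<alpha> s b"
    using b pos card_A by (simp add: field_simps)
  show "\<forall>\<^sub>F n in sequentially. s \<le> y n i \<longrightarrow> 1 / load \<alpha> (y n i) (h n) - k \<le> - (k - 1 / load \<alpha> s b)"
    using h
  proof eventually_elim
    case (elim n)
    have "1 / load \<alpha> (y n i) (h n) \<le> 1 / load \<alpha> s b" if "s \<le> y n i"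
      using load_mono[OF alpha, of s "y n i" b "h n"] that elim assms pos
      by (intro divide_left_mono) auto
    then show ?case by simp
  qed
qed (use assms in auto)

lemma leaf_lower:
  assumes "i \<in> A" "0 < s" "s' < s" and h: "\<forall>\<^sub>F n in sequentially. h n < b"
    and b: "load \<alpha> s b < 1 / k"
  shows "\<forall>\<^sub>F n in sequentially. s' < y n i"
proof (rule log_drift_lower[OF y_pos[OF assms(1)] y_drift[OF assms(1)] a_nonneg a_div y_step[OF assms(1)]])
  have pos: "0 < load \<alpha> s b" using assms(2) by (rule load_pos)
  show "0 < 1 / load \<alpha> s b - k"
    using b pos card_A by (simp add: field_simps)
  show "\<forall>\<^sub>F n in sequentially. y n i \<le> s \<longrightarrow> 1 / load \<alpha> s b - k \<le> 1 / load \<alpha> (y n i) (h n) - k"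
    using h
  proof eventually_elim
    case (elim n)
    have "1 / load \<alpha> s b \<le> 1 / load \<alpha> (y n i) (h n)" if "y n i \<le> s"
      using load_mono[OF alpha, of "y n i" s "h n" b] that elim y_pos[OF assms(1)] h_pos[of n]
        load_pos[of "y n i" \<alpha> "h n"] pos
      by (intro divide_left_mono) (auto simp: less_imp_le)
    then show ?case by simp
  qed
qed (use assms in auto)

text \<open>For \<open>\<alpha> = 1\<close> the tangent line \<open>1 / t \<ge> 2 - t\<close> bounds the drift of the hub below by
  \<open>(k - 1) (1 - h)\<close>.\<close>

lemma linear_limits:
  assumes "\<alpha> = 1"
  shows "h \<longlonglongrightarrow> 1" "\<And>i. i \<in> A \<Longrightarrow> (\<lambda>n. y n i) \<longlonglongrightarrow> 0"
proof -
  have drift: "(k - 1) * (1 - h n) \<le> (\<Sum>i\<in>A. 1 / load \<alpha> (h n) (y n i)) - k" for n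
  proof -
    have "2 - (h n + y n i) \<le> 1 / load \<alpha> (h n) (y n i)" if "i \<in> A" for i
    proof -
      have p: "0 < h n + y n i" using h_pos y_pos[OF that] by (simp add: add_pos_pos)
      have "(2 - (h n + y n i)) * (h n + y n i) \<le> 1"
        using zero_le_power2[of "h n + y n i - 1"] by (simp add: power2_eq_square algebra_simps)
      then show ?thesis using p h_pos[of n] y_pos[OF that, of n] assms by (simp add: load_def field_simps)
    qed
    then have "(\<Sum>i\<in>A. 2 - (h n + y n i)) \<le> (\<Sum>i\<in>A. 1 / load \<alpha> (h n) (y n i))"
      by (intro sum_mono)
    moreover have "(\<Sum>i\<in>A. 2 - (h n + y n i)) = (2 - h n) * k - (1 - h n)"
      using total[of n] by (simp add: sum_subtractf sum.distrib algebra_simps)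
    ultimately show ?thesis by (simp add: algebra_simps)
  qed
  have lower: "\<forall>\<^sub>F n in sequentially. s' < h n" if "s' < 1" for s'
  proof -
    define s where "s = (1 + max s' 0) / 2"
    have s: "s' < s" "0 < s" "s < 1" using that by (auto simp: s_def max_def)
    show ?thesis
    proof (rule log_drift_lower[OF h_pos h_drift a_nonneg a_div h_step])
      show "0 < (k - 1) * (1 - s)" using s card_A by simp
      show "\<forall>\<^sub>F n in sequentially. h n \<le> s \<longrightarrow>
          (k - 1) * (1 - s) \<le> (\<Sum>i\<in>A. 1 / load \<alpha> (h n) (y n i)) - k"
      proof (intro always_eventually allI impI)
        fix n assume "h n \<le> s"
        then have "(k - 1) * (1 - s) \<le> (k - 1) * (1 - h n)"
          using card_A by (intro mult_left_mono) auto
        then show "(k - 1) * (1 - s) \<le> (\<Sum>i\<in>A. 1 / load \<alpha> (h n) (y n i)) - k"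
          using drift[of n] by simp
      qed
    qed (use s in auto)
  qed
  show h: "h \<longlonglongrightarrow> 1"
    using lower less_trans[OF h_less_1] by (intro order_tendstoI) (auto intro: always_eventually)
  show "(\<lambda>n. y n i) \<longlonglongrightarrow> 0" if i: "i \<in> A" for i
  proof (rule tendsto_sandwich[OF _ _ tendsto_const])
    show "(\<lambda>n. 1 - h n) \<longlonglongrightarrow> 0" using tendsto_diff[OF tendsto_const h, of 1] by simp
  qed (use y_le[OF i] y_pos[OF i] in \<open>auto intro!: always_eventually less_imp_le\<close>)
qed

section \<open>The case \<alpha> < 1\<close>

context
  assumes alpha_less_1: "\<alpha> < 1"
begin

text \<open>\<open>r\<close> is the limiting ratio of hub to leaf. From
  \<open>k = r powr (1 - \<alpha>)\<close> one gets
  \<open>k + r = k * (1 + r powr \<alpha>)\<close>, so \<open>u = 1 / (k + r)\<close> satisfies the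
  balance \<open>load \<alpha> u (r * u) = u * (1 + r powr \<alpha>) = 1 / k\<close>.\<close>

abbreviation "r \<equiv> k powr (1 / (1 - \<alpha>))"
abbreviation "hub \<equiv> r / (k + r)"

lemma r_pos: "0 < r"
  using card_A by simp

lemma k_eq: "k = r powr (1 - \<alpha>)"
  using alpha_less_1 card_A by (simp add: powr_powr)

lemma hub_bounds: "0 < hub" "hub < 1"
proof -
  have "0 < q / (p + q) \<and> q / (p + q) < 1" if "0 < p" "0 < q" for p q :: real
    using that by simp
  moreover have "0 < k" using card_A by simp
  ultimately show "0 < hub" "hub < 1" using r_pos by blast+
qed

text \<open>With hub \<open>s\<close>, the mean leaf is \<open>u = (1 - s) / k\<close>. Then
  \<open>load \<alpha> u s - 1 / k\<close> is a positive multiple of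
  \<open>(r * u) powr (1 - \<alpha>) - s powr (1 - \<alpha>)\<close>, so its sign is that of
  \<open>r * u - s\<close>, which is also the sign of \<open>hub - s\<close>.\<close>

lemma load_mean_leaf:
  assumes "0 < s" "s \<le> 1"
  shows "s < hub \<Longrightarrow> 1 / k < load \<alpha> ((1 - s) / k) s"
    and "hub < s \<Longrightarrow> load \<alpha> ((1 - s) / k) s < 1 / k"
    and "s = hub \<Longrightarrow> load \<alpha> ((1 - s) / k) s = 1 / k"
proof -
  define u where "u = (1 - s) / k"
  have k: "0 < k" using card_A by simp
  have u: "0 \<le> u" using assms k by (simp add: u_def)
  have "load \<alpha> u s - 1 / k = u powr (1 - \<alpha>) * s powr \<alpha> - s / k"
    using k by (simp add: load_def u_def diff_divide_distrib)
  also have "s = s powr (1 - \<alpha>) * s powr \<alpha>"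
    using assms by (simp add: powr_add[symmetric])
  then have "u powr (1 - \<alpha>) * s powr \<alpha> - s / k = s powr \<alpha> / k * (k * u powr (1 - \<alpha>) - s powr (1 - \<alpha>))"
    using k by (simp add: field_simps)
  also have "k * u powr (1 - \<alpha>) = (r * u) powr (1 - \<alpha>)"
    using k_eq r_pos u by (metis less_imp_le powr_mult)
  finally have *: "load \<alpha> u s - 1 / k = s powr \<alpha> / k * ((r * u) powr (1 - \<alpha>) - s powr (1 - \<alpha>))" .
  have pos: "0 < s powr \<alpha> / k" using assms k by simp
  have cmp: "s < hub \<longleftrightarrow> s < r * u" "hub < s \<longleftrightarrow> r * u < s" "s = hub \<longleftrightarrow> s = r * u"
    using k r_pos add_pos_pos[OF k r_pos] by (auto simp: u_def field_simps)
  have ru: "0 \<le> r * u" using u by simp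
  show "1 / k < load \<alpha> ((1 - s) / k) s" if "s < hub"
  proof -
    have "s powr (1 - \<alpha>) < (r * u) powr (1 - \<alpha>)"
      using that cmp(1) assms alpha_less_1 by (intro powr_less_mono2) auto
    then have "0 < load \<alpha> u s - 1 / k" unfolding * by (intro mult_pos_pos pos) simp
    then show ?thesis by (simp add: u_def)
  qed
  show "load \<alpha> ((1 - s) / k) s < 1 / k" if "hub < s"
  proof -
    have "(r * u) powr (1 - \<alpha>) < s powr (1 - \<alpha>)"
      using that cmp(2) ru alpha_less_1 by (intro powr_less_mono2) auto
    then have "load \<alpha> u s - 1 / k < 0" unfolding * by (intro mult_pos_neg pos) simp
    then show ?thesis by (simp add: u_def)
  qed
  show "load \<alpha> ((1 - s) / k) s = 1 / k" if "s = hub"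
    using * cmp(3) that unfolding u_def by simp
qed

text \<open>This provides the positive initial bound that the improvement argument needs, since
  \<open>load_mean_leaf\<close> gives nothing at \<open>s = 0\<close>. When the hub is small, it
  wins so often relative to its size that its own drift is at least \<open>k\<close>.\<close>

lemma hub_bounded_below: "\<exists>b>0. \<forall>\<^sub>F n in sequentially. b < h n"
proof -
  \<comment> \<open>Chosen so that \<open>s powr (1 - \<alpha>) = 1 / 4\<close>. As
    \<open>1 / (1 - \<alpha>) \<ge> 1\<close>, also \<open>s \<le> 1 / 4\<close>, whence
    \<open>load \<alpha> s 1 \<le> 1 / 2\<close> and each of the \<open>k\<close> terms of the hub
    drift is at least 2.\<close>
  define s where "s = (1 / 4 :: real) powr (1 / (1 - \<alpha>))"
  have s: "0 < s" by (simp add: s_def)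
  have s4: "s powr (1 - \<alpha>) = 1 / 4" using alpha_less_1 by (simp add: s_def powr_powr)
  have "s \<le> (1 / 4) powr 1"
    unfolding s_def using alpha alpha_less_1 by (intro powr_mono') (auto simp: field_simps)
  then have s1: "s \<le> 1 / 4" by simp
  have k: "0 < k" using card_A by simp
  have "\<forall>\<^sub>F n in sequentially. s / 2 < h n"
  proof (rule log_drift_lower[OF h_pos h_drift a_nonneg a_div h_step k s])
    show "\<forall>\<^sub>F n in sequentially. h n \<le> s \<longrightarrow> k \<le> (\<Sum>i\<in>A. 1 / load \<alpha> (h n) (y n i)) - k"
    proof (intro always_eventually allI impI)
      fix n assume n: "h n \<le> s"
      have "2 \<le> 1 / load \<alpha> (h n) (y n i)" if "i \<in> A" for i
      proof -
        have "load \<alpha> (h n) (y n i) \<le> load \<alpha> s 1"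
          using n h_pos[of n] y_pos[OF that, of n] y_le[OF that, of n]
          by (intro load_mono[OF alpha]) auto
        also have "\<dots> \<le> 1 / 2" using s1 s4 by (simp add: load_def)
        finally show ?thesis using load_pos[OF h_pos, of \<alpha> n "y n i"] by (simp add: field_simps)
      qed
      then have "(\<Sum>i\<in>A. 2) \<le> (\<Sum>i\<in>A. 1 / load \<alpha> (h n) (y n i))" by (rule sum_mono)
      then show "k \<le> (\<Sum>i\<in>A. 1 / load \<alpha> (h n) (y n i)) - k" by simp
    qed
  qed (use s in auto)
  then show ?thesis using s by (intro exI[of _ "s / 2"]) auto
qed

text \<open>If the largest asymptotic lower bound \<open>s\<close> of the hub were below \<open>hub\<close>, all leaves would
  eventually fall strictly below \<open>(1 - s) / k\<close>, and then the hub would exceed \<open>s\<close> by a margin.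
  The upper bound is dual.\<close>

lemma hub_eventually_greater:
  assumes "b < hub"
  shows "\<forall>\<^sub>F n in sequentially. b < h n"
proof -
  define T where "T = {b. \<forall>\<^sub>F n in sequentially. b < h n}"
  have le1: "b \<le> 1" if "b \<in> T" for b
  proof -
    have "\<exists>n. b < h n" using that unfolding T_def by (auto simp: eventually_sequentially)
    then show ?thesis using h_less_1 by (meson less_imp_le less_trans)
  qed
  then have bdd: "bdd_above T" by (auto simp: bdd_above_def)
  obtain b0 where b0: "0 < b0" "b0 \<in> T" using hub_bounded_below by (auto simp: T_def)
  define s where "s = Sup T"
  have s0: "0 < s" using cSup_upper[OF b0(2) bdd] b0(1) by (simp add: s_def)
  have s1: "s \<le> 1" unfolding s_def using b0 le1 by (intro cSup_least) auto
  have below: "c \<in> T" if "c < s" for c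
  proof -
    have "\<exists>x\<in>T. c < x" using that b0(2) unfolding s_def by (intro less_cSupD) auto
    then show ?thesis unfolding T_def by (auto elim!: eventually_mono)
  qed
  have k: "0 < k" using card_A by simp
  have "hub \<le> s"
  proof (rule ccontr)
    assume "\<not> hub \<le> s"
    then have s: "s < hub" by simp
    then have us: "0 < (1 - s) / k" using hub_bounds(2) k by simp
    \<comment> \<open>The value \<open>s\<close> itself need not be an asymptotic lower bound, but
      every \<open>s - e\<close> is. The strict inequality at \<open>s\<close> survives such a small
      change in both arguments.\<close>
    have "((\<lambda>e. load \<alpha> ((1 - s) / k - e) (s - e)) \<longlongrightarrow> load \<alpha> ((1 - s) / k) s) (at_right 0)"
    proof (rule load_tendsto[OF alpha(1) alpha_less_1])
      show "\<forall>\<^sub>F e in at_right 0. 0 \<le> (1 - s) / k - e"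
        using eventually_at_right_less us by (auto simp: eventually_at_right_field intro!: exI[of _ "(1 - s) / k"])
      show "\<forall>\<^sub>F e in at_right 0. 0 \<le> s - e"
        using s0 by (auto simp: eventually_at_right_field intro!: exI[of _ s])
      show "((\<lambda>e. (1 - s) / k - e) \<longlongrightarrow> (1 - s) / k) (at_right 0)" "((\<lambda>e. s - e) \<longlongrightarrow> s) (at_right 0)"
        by (auto intro!: tendsto_eq_intros)
    qed (use us s0 in auto)
    then have "\<forall>\<^sub>F e in at_right 0. 1 / k < load \<alpha> ((1 - s) / k - e) (s - e)"
      using load_mean_leaf(1)[OF s0 s1 s] by (rule order_tendstoD(1))
    moreover have "\<forall>\<^sub>F e in at_right 0. 0 < e \<and> e < (1 - s) / k \<and> e < s"
      using us s0 by (auto simp: eventually_at_right_field intro!: exI[of _ "min s ((1 - s) / k)"])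
    ultimately have "\<forall>\<^sub>F e in at_right 0. 1 / k < load \<alpha> ((1 - s) / k - e) (s - e) \<and>
        0 < e \<and> e < (1 - s) / k \<and> e < s"
      by (rule eventually_conj)
    then obtain e where e: "1 / k < load \<alpha> ((1 - s) / k - e) (s - e)" "0 < e" "e < (1 - s) / k" "e < s"
      using eventually_happens'[OF trivial_limit_at_right_real] by blast
    have "\<forall>\<^sub>F n in sequentially. s - e < h n"
      using below[of "s - e"] e by (simp add: T_def)
    \<comment> \<open>\<open>leaf_upper\<close> needs a strict gap between its two levels, which
      costs half of \<open>e\<close>; the other half, summed over the \<open>k\<close> leaves, is
      the gain of the hub that contradicts the choice of \<open>s\<close>.\<close>
    then have "\<forall>\<^sub>F n in sequentially. y n i < (1 - s) / k - e / 2" if "i \<in> A" for i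
      using that e by (intro leaf_upper[of i "(1 - s) / k - e" _ "s - e"]) auto
    then have "\<forall>\<^sub>F n in sequentially. \<forall>i\<in>A. y n i < (1 - s) / k - e / 2"
      using finite_A by (simp add: eventually_ball_finite)
    then have "\<forall>\<^sub>F n in sequentially. s + k * (e / 2) < h n"
    proof eventually_elim
      case (elim n)
      then have "(\<Sum>i\<in>A. y n i) < (\<Sum>i\<in>A. (1 - s) / k - e / 2)"
        using finite_A A_nonempty by (intro sum_strict_mono) auto
      also have "\<dots> = 1 - s - k * (e / 2)" using k by (simp add: field_simps)
      finally show ?case using total[of n] by simp
    qed
    then have "s + k * (e / 2) \<le> s"
      unfolding s_def using bdd by (intro cSup_upper) (auto simp: T_def)
    then show False using k e(2) by (simp add: mult_le_0_iff)
  qed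
  then show ?thesis using below assms by (simp add: T_def)
qed

lemma hub_eventually_less:
  assumes "hub < b"
  shows "\<forall>\<^sub>F n in sequentially. h n < b"
proof -
  define T where "T = {b. \<forall>\<^sub>F n in sequentially. h n < b}"
  have ge: "hub \<le> b" if b: "b \<in> T" for b
  proof (rule ccontr)
    assume "\<not> hub \<le> b"
    then have "\<forall>\<^sub>F n in sequentially. b < h n \<and> h n < b"
      using hub_eventually_greater[of b] b by (simp add: T_def eventually_conj)
    then show False by (auto simp: eventually_sequentially)
  qed
  then have bdd: "bdd_below T" by (auto simp: bdd_below_def)
  have T1: "1 \<in> T" using h_less_1 by (simp add: T_def)
  define s where "s = Inf T"
  have s1: "s \<le> 1" unfolding s_def using T1 bdd by (rule cInf_lower)
  \<comment> \<open>Here positivity of \<open>s\<close> comes from the lower bound already proved,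
    so no separate initial estimate is needed; the trivial bound 1 makes \<open>T\<close>
    nonempty.\<close>
  have "hub \<le> s" unfolding s_def using T1 ge by (intro cInf_greatest) auto
  then have s0: "0 < s" using hub_bounds(1) by simp
  have above: "c \<in> T" if "s < c" for c
  proof -
    have "\<exists>x\<in>T. x < c" using that T1 unfolding s_def by (intro cInf_lessD) auto
    then show ?thesis unfolding T_def by (auto elim!: eventually_mono)
  qed
  have k: "0 < k" using card_A by simp
  have us: "0 \<le> (1 - s) / k" using s1 k by simp
  have "s \<le> hub"
  proof (rule ccontr)
    assume "\<not> s \<le> hub"
    then have s: "hub < s" by simp
    have "((\<lambda>e. load \<alpha> ((1 - s) / k + e) (s + e)) \<longlongrightarrow> load \<alpha> ((1 - s) / k) s) (at_right 0)"
    proof (rule load_tendsto[OF alpha(1) alpha_less_1])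
      show "\<forall>\<^sub>F e in at_right 0. 0 \<le> (1 - s) / k + e" "\<forall>\<^sub>F e in at_right 0. 0 \<le> s + e"
        using s0 us by (auto simp: eventually_at_right_field intro!: exI[of _ 1] add_nonneg_nonneg)
      show "((\<lambda>e. (1 - s) / k + e) \<longlongrightarrow> (1 - s) / k) (at_right 0)" "((\<lambda>e. s + e) \<longlongrightarrow> s) (at_right 0)"
        by (auto intro!: tendsto_eq_intros)
    qed (use us s0 in auto)
    then have "\<forall>\<^sub>F e in at_right 0. load \<alpha> ((1 - s) / k + e) (s + e) < 1 / k"
      using load_mean_leaf(2)[OF s0 s1 s] by (rule order_tendstoD(2))
    then have "\<forall>\<^sub>F e in at_right 0. load \<alpha> ((1 - s) / k + e) (s + e) < 1 / k \<and> 0 < e"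
      using eventually_at_right_less by (rule eventually_conj)
    then obtain e where e: "load \<alpha> ((1 - s) / k + e) (s + e) < 1 / k" "0 < e"
      using eventually_happens'[OF trivial_limit_at_right_real] by blast
    have "\<forall>\<^sub>F n in sequentially. h n < s + e"
      using above[of "s + e"] e by (simp add: T_def)
    then have "\<forall>\<^sub>F n in sequentially. (1 - s) / k + e / 2 < y n i" if "i \<in> A" for i
      using that e us by (intro leaf_lower[of i "(1 - s) / k + e" _ "s + e"]) auto
    then have "\<forall>\<^sub>F n in sequentially. \<forall>i\<in>A. (1 - s) / k + e / 2 < y n i"
      using finite_A by (simp add: eventually_ball_finite)
    then have "\<forall>\<^sub>F n in sequentially. h n < s - k * (e / 2)"
    proof eventually_elim
      case (elim n)
      have "1 - s + k * (e / 2) = (\<Sum>i\<in>A. (1 - s) / k + e / 2)" using k by (simp add: field_simps)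
      also have "\<dots> < (\<Sum>i\<in>A. y n i)"
        using elim finite_A A_nonempty by (intro sum_strict_mono) auto
      finally show ?case using total[of n] by simp
    qed
    then have "s \<le> s - k * (e / 2)"
      unfolding s_def using bdd by (intro cInf_lower) (auto simp: T_def)
    then show False using k e(2) by (simp add: mult_le_0_iff)
  qed
  then show ?thesis using above assms by (simp add: T_def)
qed

lemma sublinear_hub_limit: "h \<longlonglongrightarrow> hub"
  using hub_eventually_greater hub_eventually_less by (intro order_tendstoI) auto

text \<open>The upper bound comes from the drift, with the hub close to its limit. The lower bound
  needs no drift: the hub and the other leaves are almost bounded by their limits, and the
  proportions sum to 1.\<close>

lemma sublinear_leaf_limit:
  assumes i: "i \<in> A"
  shows "(\<lambda>n. y n i) \<longlonglongrightarrow> 1 / (k + r)"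
proof -
  have k: "0 < k" using card_A by simp
  define u where "u = 1 / (k + r)"
  have u: "0 < u" "(1 - hub) / k = u"
  proof -
    have "(1 - q / (p + q)) / p = 1 / (p + q)" if "0 < p" "0 < q" for p q :: real
      using that add_pos_pos[OF that] by (simp add: divide_simps)
    from this[OF k r_pos] show "(1 - hub) / k = u" by (simp add: u_def)
    show "0 < u" using add_pos_pos[OF k r_pos] by (simp add: u_def)
  qed
  have load_u: "load \<alpha> u hub = 1 / k"
    using load_mean_leaf(3)[of hub] hub_bounds u by simp
  have upper: "\<forall>\<^sub>F n in sequentially. y n j < t" if "j \<in> A" "u < t" for j t
  proof -
    define s where "s = (u + t) / 2"
    have s: "u < s" "s < t" using that by (auto simp: s_def)
    \<comment> \<open>The summand \<open>u\<close> alone makes the load strictly increasing in its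
      first argument.\<close>
    have "1 / k < load \<alpha> s hub"
      using mult_right_mono[OF powr_mono2[of "1 - \<alpha>" u s], of "hub powr \<alpha>"] load_u s u alpha_less_1
      by (simp add: load_def)
    moreover have "((\<lambda>e. load \<alpha> s (hub - e)) \<longlongrightarrow> load \<alpha> s hub) (at_right 0)"
    proof (rule load_tendsto[OF alpha(1) alpha_less_1])
      show "\<forall>\<^sub>F e in at_right 0. 0 \<le> hub - e"
        using hub_bounds by (auto simp: eventually_at_right_field intro!: exI[of _ hub])
      show "((\<lambda>e. hub - e) \<longlongrightarrow> hub) (at_right 0)" by (auto intro!: tendsto_eq_intros)
    qed (use s u hub_bounds in auto)
    ultimately have "\<forall>\<^sub>F e in at_right 0. 1 / k < load \<alpha> s (hub - e)"
      by (metis order_tendstoD(1))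
    moreover have "\<forall>\<^sub>F e in at_right 0. 0 < e \<and> e < hub"
      using hub_bounds by (auto simp: eventually_at_right_field intro!: exI[of _ hub])
    ultimately have "\<forall>\<^sub>F e in at_right 0. 1 / k < load \<alpha> s (hub - e) \<and> 0 < e \<and> e < hub"
      by (rule eventually_conj)
    then obtain e where e: "1 / k < load \<alpha> s (hub - e)" "0 < e" "e < hub"
      using eventually_happens'[OF trivial_limit_at_right_real] by blast
    have "\<forall>\<^sub>F n in sequentially. hub - e < h n"
      using e by (intro hub_eventually_greater) simp
    then show ?thesis
      using that s e u by (intro leaf_upper[of j s t "hub - e"]) auto
  qed
  have lower: "\<forall>\<^sub>F n in sequentially. t < y n i" if "t < u" for t
  proof -
    \<comment> \<open>The hub and the \<open>k - 1\<close> other leaves together exceed their limits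
      by less than \<open>k * e\<close>, which leaves more than \<open>u - k * e = t + e\<close> for
      leaf \<open>i\<close>.\<close>
    define e where "e = (u - t) / (k + 1)"
    have "0 < e" using that k by (simp add: e_def)
    moreover have "(k + 1) * e = u - t" using k by (simp add: e_def)
    ultimately have e: "0 < e" "e + k * e = u - t" by (simp_all add: distrib_right)
    have "\<forall>\<^sub>F n in sequentially. \<forall>j\<in>A. y n j < u + e"
      using finite_A upper e by (simp add: eventually_ball_finite)
    moreover have "\<forall>\<^sub>F n in sequentially. h n < hub + e"
      using e by (intro hub_eventually_less) simp
    ultimately show ?thesis
    proof eventually_elim
      case (elim n)
      have "(\<Sum>j\<in>A - {i}. y n j) \<le> (\<Sum>j\<in>A - {i}. u + e)"
        using elim by (intro sum_mono) (auto simp: less_imp_le)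
      also have "\<dots> = (k - 1) * (u + e)"
        using i finite_A card_A by (simp add: card_Diff_singleton of_nat_diff)
      finally have "(\<Sum>j\<in>A - {i}. y n j) \<le> (k - 1) * (u + e)" .
      moreover have "(\<Sum>j\<in>A. y n j) = y n i + (\<Sum>j\<in>A - {i}. y n j)"
        using i finite_A by (rule sum.remove[rotated])
      moreover have "hub + k * u = 1" using u(2) k by (simp add: field_simps)
      ultimately show ?case using total[of n] elim e by (simp add: algebra_simps)
    qed
  qed
  show ?thesis unfolding u_def[symmetric]
    using lower upper[OF i] by (intro order_tendstoI) auto
qed

end

end

section \<open>The urn process\<close>

lemma measurable_tendsto_const:
  fixes f :: "nat \<Rightarrow> 'w \<Rightarrow> real"
  assumes [measurable]: "\<And>n. f n \<in> borel_measurable M"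
  shows "{\<omega> \<in> space M. (\<lambda>n. f n \<omega>) \<longlonglongrightarrow> l} \<in> sets M"
proof -
  have "((\<lambda>n. f n \<omega>) \<longlonglongrightarrow> l) = (\<forall>q::nat. \<exists>N. \<forall>n\<ge>N. \<bar>f n \<omega> - l\<bar> < 1 / real (Suc q))" for \<omega>
  proof
    assume "(\<lambda>n. f n \<omega>) \<longlonglongrightarrow> l"
    then show "\<forall>q::nat. \<exists>N. \<forall>n\<ge>N. \<bar>f n \<omega> - l\<bar> < 1 / real (Suc q)"
      unfolding lim_sequentially dist_real_def by simp
  next
    assume R: "\<forall>q::nat. \<exists>N. \<forall>n\<ge>N. \<bar>f n \<omega> - l\<bar> < 1 / real (Suc q)"
    show "(\<lambda>n. f n \<omega>) \<longlonglongrightarrow> l"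
      unfolding lim_sequentially dist_real_def
    proof (intro allI impI)
      fix e :: real assume "0 < e"
      then obtain q where "1 / real (Suc q) < e" using nat_approx_posE by blast
      then show "\<exists>N. \<forall>n\<ge>N. \<bar>f n \<omega> - l\<bar> < e" using R by (meson less_trans)
    qed
  qed
  then show ?thesis by simp
qed

context polya_urn
begin

lemma finite_E: "finite E"
  using finite_V edges by (intro finite_subset[of E "Pow V"]) auto

lemma choice_in: "\<omega> \<in> space M \<Longrightarrow> e \<in> E \<Longrightarrow> C n e \<omega> \<in> e"
  using measurable_space[OF choice_measurable] by auto

text \<open>\<open>C k e\<close> is measurable into the discrete space on \<open>e\<close> only; as
  its values lie in \<open>e\<close>, an arbitrary \<open>A\<close> may be cut down to
  \<open>A \<inter> e\<close>.\<close>

lemma choice_event [measurable]: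
  assumes "e \<in> E"
  shows "C k e -` A \<inter> space M \<in> events"
proof -
  have "C k e -` (A \<inter> e) \<inter> space M \<in> events"
    by (rule measurable_sets[OF choice_measurable[OF assms]]) simp
  also have "C k e -` (A \<inter> e) \<inter> space M = C k e -` A \<inter> space M"
    using choice_in[OF _ assms] by blast
  finally show ?thesis .
qed

lemma space_history [simp]: "space (history M E C n) = space M"
  by (simp add: history_def space_measure_of_conv)

lemma sets_history:
  "sets (history M E C n) = sigma_sets (space M) {C k e -` A \<inter> space M | k e A. k < n \<and> e \<in> E}"
  unfolding history_def by (intro sets_measure_of) auto

lemma subalgebra_history: "subalgebra M (history M E C n)"
  unfolding subalgebra_def sets_history
  by (auto intro!: sets.sigma_sets_subset choice_event)

lemma sigma_finite_history: "sigma_finite_subalgebra M (history M E C n)"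
  using subalgebra_history
  by (intro finite_measure_subalgebra_is_sigma_finite finite_measure_subalgebra.intro
      finite_measure_subalgebra_axioms.intro) (rule finite_measure_axioms)

lemma history_mono: "m \<le> n \<Longrightarrow> sets (history M E C m) \<subseteq> sets (history M E C n)"
  unfolding sets_history by (intro sigma_sets_mono') (blast intro: less_le_trans)

lemma choice_history:
  assumes "k < n" "e \<in> E"
  shows "{\<omega> \<in> space M. C k e \<omega> = i} \<in> sets (history M E C n)"
proof -
  have "{\<omega> \<in> space M. C k e \<omega> = i} = C k e -` {i} \<inter> space M" by auto
  then show ?thesis unfolding sets_history using assms by (intro sigma_sets.Basic) blast
qed

lemma choice_event_eq [measurable]:
  assumes "e \<in> E"
  shows "{\<omega> \<in> space M. C k e \<omega> = i} \<in> events"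
  using choice_history[OF lessI assms] subalgebra_history by (auto simp: subalgebra_def)

lemma balls_increment:
  "balls E b C (Suc n) i \<omega> = balls E b C n i \<omega> + (\<Sum>e\<in>E. if C n e \<omega> = i then 1 else 0)"
  using finite_E by (simp add: sum.If_cases Int_def)

lemma balls_history: "k \<le> n \<Longrightarrow> (\<lambda>\<omega>. real (balls E b C k i \<omega>)) \<in> borel_measurable (history M E C n)"
proof (induction k)
  case (Suc k)
  have [measurable]: "{\<omega> \<in> space (history M E C n). C k e \<omega> = i} \<in> sets (history M E C n)" if "e \<in> E" for e
    using choice_history[of k n e i] Suc that by simp
  have [measurable]: "(\<lambda>\<omega>. real (balls E b C k i \<omega>)) \<in> borel_measurable (history M E C n)"
    using Suc by simp
  have "(\<lambda>\<omega>. real (balls E b C k i \<omega>) + (\<Sum>e\<in>E. if C k e \<omega> = i then 1 else 0)) \<in> borel_measurable (history M E C n)"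
    by measurable
  then show ?case unfolding balls_increment by (simp del: balls.simps if_distrib add: of_nat_sum if_distrib[of real] cong: if_cong)
qed simp

lemma balls_measurable [measurable]: "(\<lambda>\<omega>. real (balls E b C n i \<omega>)) \<in> borel_measurable M"
  using measurable_from_subalg[OF subalgebra_history balls_history[OF order_refl]] .

lemma balls_mono: "balls E b C n i \<omega> \<le> balls E b C (Suc n) i \<omega>"
  by simp

lemma balls_increment_le: "balls E b C (Suc n) i \<omega> \<le> balls E b C n i \<omega> + card E"
  using finite_E by (auto intro!: card_mono)

lemma balls_pos: "i \<in> V \<Longrightarrow> 0 < balls E b C n i \<omega>"
  using initial[of i] by (induction n) auto

section \<open>Choice probabilities and the noise at a vertex\<close>

definition choice_rate :: "nat \<Rightarrow> 'v \<Rightarrow> 'v \<Rightarrow> 'w \<Rightarrow> real" where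
  "choice_rate n i j \<omega> = real (balls E b C n i \<omega>) powr \<alpha> /
     (real (balls E b C n i \<omega>) powr \<alpha> + real (balls E b C n j \<omega>) powr \<alpha>)"

lemma choice_rate_bounds: "0 \<le> choice_rate n i j \<omega>" "choice_rate n i j \<omega> \<le> 1"
proof -
  have "0 \<le> x / (x + y) \<and> x / (x + y) \<le> 1" if "0 \<le> x" "0 \<le> y" for x y :: real
    using that by (cases "x + y = 0") (simp_all add: divide_le_eq)
  then show "0 \<le> choice_rate n i j \<omega>" "choice_rate n i j \<omega> \<le> 1"
    by (simp_all add: choice_rate_def)
qed

lemma choice_rate_history: "choice_rate n i j \<in> borel_measurable (history M E C n)"
proof -
  note [measurable] = balls_history[OF order_refl]
  show ?thesis unfolding choice_rate_def by measurable
qed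

lemma edge_in_V: "{i, j} \<in> E \<Longrightarrow> i \<in> V \<and> j \<in> V \<and> i \<noteq> j"
  using edges[of "{i, j}"] by (auto simp: card_insert_if split: if_splits)

text \<open>The tested form of \<open>choice_prob\<close>. It yields the orthogonality of the noise
  and, in the variance bound, the exchange of a probability for the indicator of an actual
  placement.\<close>

lemma integral_choice:
  assumes e: "{i, j} \<in> E" and X: "X \<in> borel_measurable (history M E C n)"
    and bnd: "\<And>\<omega>. \<omega> \<in> space M \<Longrightarrow> \<bar>X \<omega>\<bar> \<le> B"
  shows "(\<integral>\<omega>. X \<omega> * indicator {\<omega> \<in> space M. C n {i, j} \<omega> = i} \<omega> \<partial>M) =
    (\<integral>\<omega>. X \<omega> * choice_rate n i j \<omega> \<partial>M)"
proof -
  interpret h: sigma_finite_subalgebra M "history M E C n" by (rule sigma_finite_history)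
  let ?A = "{\<omega> \<in> space M. C n {i, j} \<omega> = i}"
  have A: "?A \<in> events" using e by (rule choice_event_eq)
  have XM: "X \<in> borel_measurable M" using measurable_from_subalg[OF subalgebra_history X] .
  have int: "integrable M (\<lambda>\<omega>. X \<omega> * indicator ?A \<omega>)"
  proof (rule integrable_real_bounded)
    show "\<bar>X \<omega> * indicator ?A \<omega>\<bar> \<le> B" if "\<omega> \<in> space M" for \<omega>
      using bnd[OF that] by (auto simp: indicator_def)
  qed (use XM A in measurable)
  have "(\<integral>\<omega>. X \<omega> * indicator ?A \<omega> \<partial>M) = (\<integral>\<omega>. X \<omega> * cond_prob_history M E C n ?A \<omega> \<partial>M)"
    using A by (intro h.real_cond_exp_intg(2)[symmetric] int X) auto
  also have "\<dots> = (\<integral>\<omega>. X \<omega> * choice_rate n i j \<omega> \<partial>M)"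
  proof (rule integral_cong_AE)
    show "(\<lambda>\<omega>. X \<omega> * choice_rate n i j \<omega>) \<in> borel_measurable M"
      using XM measurable_from_subalg[OF subalgebra_history choice_rate_history] by measurable
    show "AE \<omega> in M. X \<omega> * cond_prob_history M E C n ?A \<omega> = X \<omega> * choice_rate n i j \<omega>"
      using choice_prob[OF e, of n] by (auto simp: choice_rate_def)
  qed (use XM in measurable)
  finally show ?thesis .
qed

lemma AE_summable_choice_noise:
  assumes e: "{i, j} \<in> E"
  shows "AE \<omega> in M. summable (\<lambda>n. ((if C n {i, j} \<omega> = i then 1 else 0) - choice_rate n i j \<omega>) /
    real (balls E b C n i \<omega>))"
proof -
  define I where "I n = indicat_real {\<omega> \<in> space M. C n {i, j} \<omega> = i}" for n
  define Z where "Z n \<omega> = real (balls E b C n i \<omega>)" for n \<omega>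
  define p where "p n = choice_rate n i j" for n
  define d where "d n \<omega> = (I n \<omega> - p n \<omega>) / Z n \<omega>" for n \<omega>
  have iV: "i \<in> V" using edge_in_V[OF e] by simp
  have Z1: "1 \<le> Z n \<omega>" for n \<omega>
    using balls_pos[OF iV, of n \<omega>] by (simp add: Z_def)
  have I_hist: "I n \<in> borel_measurable (history M E C (Suc n))" for n
    unfolding I_def using choice_history[OF lessI e] by measurable
  have Z_hist: "Z n \<in> borel_measurable (history M E C m)" if "n \<le> m" for m n
    unfolding Z_def by (rule balls_history[OF that])
  have p_hist: "p n \<in> borel_measurable (history M E C m)" if "n \<le> m" for m n
    using measurable_mono[of borel borel "history M E C n" "history M E C m"]
      choice_rate_history[of n i j] history_mono[OF that] by (auto simp: p_def)
  note M = measurable_from_subalg[OF subalgebra_history]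
  note [measurable] = M[OF I_hist] M[OF Z_hist[OF order_refl]] M[OF p_hist[OF order_refl]]
  have I01: "0 \<le> I n \<omega>" "I n \<omega> \<le> 1" for n \<omega> by (auto simp: I_def indicator_def)
  have p01: "0 \<le> p n \<omega>" "p n \<omega> \<le> 1" for n \<omega>
    using choice_rate_bounds by (auto simp: p_def)
  have d1: "\<bar>d n \<omega>\<bar> \<le> 1" for n \<omega>
  proof -
    have "\<bar>I n \<omega> - p n \<omega>\<bar> \<le> 1 * Z n \<omega>" using I01[of n \<omega>] p01[of n \<omega>] Z1[of n \<omega>] by auto
    then show ?thesis using Z1[of n \<omega>] by (simp add: d_def divide_le_eq)
  qed
  have orth: "(\<integral>\<omega>. X \<omega> * I n \<omega> \<partial>M) = (\<integral>\<omega>. X \<omega> * p n \<omega> \<partial>M)"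
    if "X \<in> borel_measurable (history M E C n)" "\<And>\<omega>. \<omega> \<in> space M \<Longrightarrow> \<bar>X \<omega>\<bar> \<le> B" for X n B
    unfolding I_def p_def using integral_choice[OF e that] .
  interpret d: bounded_martingale_differences M "history M E C" d 1
  proof unfold_locales
    show "d n \<in> borel_measurable (history M E C (Suc n))" for n
      unfolding d_def using I_hist Z_hist[of n "Suc n"] p_hist[of n "Suc n"] by simp
    fix n X B
    assume X: "X \<in> borel_measurable (history M E C n)"
      and bnd: "\<And>\<omega>. \<omega> \<in> space M \<Longrightarrow> \<bar>X \<omega>\<bar> \<le> (B :: real)"
    have XZ: "\<bar>X \<omega> / Z n \<omega>\<bar> \<le> B" if "\<omega> \<in> space M" for \<omega>
    proof -
      have "\<bar>X \<omega> / Z n \<omega>\<bar> \<le> \<bar>X \<omega>\<bar>"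
        using Z1[of n \<omega>] mult_left_mono[OF Z1[of n \<omega>], of "\<bar>X \<omega>\<bar>"] by (simp add: divide_le_eq)
      then show ?thesis using bnd[OF that] by simp
    qed
    have XZ_hist: "(\<lambda>\<omega>. X \<omega> / Z n \<omega>) \<in> borel_measurable (history M E C n)"
      using X Z_hist[OF order_refl] by simp
    note [measurable] = M[OF X]
    have int: "integrable M (\<lambda>\<omega>. X \<omega> / Z n \<omega> * q \<omega>)"
      if q: "q \<in> borel_measurable M" "\<And>\<omega>. 0 \<le> q \<omega>" "\<And>\<omega>. q \<omega> \<le> 1" for q
    proof (rule integrable_real_bounded)
      show "\<bar>X \<omega> / Z n \<omega> * q \<omega>\<bar> \<le> B * 1" if "\<omega> \<in> space M" for \<omega>
        unfolding abs_mult using XZ[OF that] q(2,3)[of \<omega>] order_trans[OF abs_ge_zero bnd[OF that]] by (intro mult_mono) auto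
    qed (use q in measurable)
    have "(\<integral>\<omega>. X \<omega> * d n \<omega> \<partial>M) = (\<integral>\<omega>. X \<omega> / Z n \<omega> * I n \<omega> - X \<omega> / Z n \<omega> * p n \<omega> \<partial>M)"
      by (intro Bochner_Integration.integral_cong) (auto simp: d_def field_simps diff_divide_distrib)
    also have "\<dots> = (\<integral>\<omega>. X \<omega> / Z n \<omega> * I n \<omega> \<partial>M) - (\<integral>\<omega>. X \<omega> / Z n \<omega> * p n \<omega> \<partial>M)"
      using I01 p01 by (intro Bochner_Integration.integral_diff int) auto
    also have "\<dots> = 0" using orth[OF XZ_hist XZ] by simp
    finally show "(\<integral>\<omega>. X \<omega> * d n \<omega> \<partial>M) = 0" .
  qed (use subalgebra_history history_mono d1 in auto)
  \<comment> \<open>Since \<open>(I - p)^2 \<le> I + p\<close>, and \<open>I\<close> and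
    \<open>p\<close> have the same integral against the weight \<open>1 / Z^2\<close>, the variance
    is bounded through \<open>I\<close> alone. This matters because only actual placements make the
    sum telescope along a path.\<close>
  have second_moment: "(\<integral>\<omega>. (d n \<omega>)\<^sup>2 \<partial>M) \<le> 2 * (\<integral>\<omega>. I n \<omega> / (Z n \<omega>)\<^sup>2 \<partial>M)" for n
  proof -
    have Z2: "\<bar>1 / (Z n \<omega>)\<^sup>2\<bar> \<le> 1" for \<omega>
      using Z1[of n \<omega>] by (simp add: divide_le_eq)
    have int: "integrable M (\<lambda>\<omega>. 1 / (Z n \<omega>)\<^sup>2 * q \<omega>)"
      if q: "q \<in> borel_measurable M" "\<And>\<omega>. 0 \<le> q \<omega>" "\<And>\<omega>. q \<omega> \<le> 1" for q
    proof (rule integrable_real_bounded)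
      show "\<bar>1 / (Z n \<omega>)\<^sup>2 * q \<omega>\<bar> \<le> 1 * 1" for \<omega>
        unfolding abs_mult using Z2[of \<omega>] q(2,3)[of \<omega>] by (intro mult_mono) auto
    qed (use q in measurable)
    have "(\<integral>\<omega>. (d n \<omega>)\<^sup>2 \<partial>M) \<le> (\<integral>\<omega>. 1 / (Z n \<omega>)\<^sup>2 * I n \<omega> + 1 / (Z n \<omega>)\<^sup>2 * p n \<omega> \<partial>M)"
    proof (rule integral_mono[OF d.integrable_d_square])
      show "integrable M (\<lambda>\<omega>. 1 / (Z n \<omega>)\<^sup>2 * I n \<omega> + 1 / (Z n \<omega>)\<^sup>2 * p n \<omega>)"
        using I01 p01 by (intro Bochner_Integration.integrable_add int) auto
      fix \<omega>
      have "\<bar>I n \<omega> - p n \<omega>\<bar> * \<bar>I n \<omega> - p n \<omega>\<bar> \<le> \<bar>I n \<omega> - p n \<omega>\<bar> * 1"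
        using I01[of n \<omega>] p01[of n \<omega>] by (intro mult_left_mono) auto
      then have "(I n \<omega> - p n \<omega>)\<^sup>2 \<le> \<bar>I n \<omega> - p n \<omega>\<bar>"
        by (simp add: power2_eq_square abs_mult[symmetric] del: abs_mult_self_eq)
      also have "\<dots> \<le> I n \<omega> + p n \<omega>" using I01[of n \<omega>] p01[of n \<omega>] by auto
      finally have "(I n \<omega> - p n \<omega>)\<^sup>2 / (Z n \<omega>)\<^sup>2 \<le> (I n \<omega> + p n \<omega>) / (Z n \<omega>)\<^sup>2"
        by (intro divide_right_mono) auto
      then show "(d n \<omega>)\<^sup>2 \<le> 1 / (Z n \<omega>)\<^sup>2 * I n \<omega> + 1 / (Z n \<omega>)\<^sup>2 * p n \<omega>"
        by (simp add: d_def power_divide add_divide_distrib)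
    qed
    also have "\<dots> = (\<integral>\<omega>. 1 / (Z n \<omega>)\<^sup>2 * I n \<omega> \<partial>M) + (\<integral>\<omega>. 1 / (Z n \<omega>)\<^sup>2 * p n \<omega> \<partial>M)"
      using I01 p01 by (intro Bochner_Integration.integral_add int) auto
    also have "(\<integral>\<omega>. 1 / (Z n \<omega>)\<^sup>2 * p n \<omega> \<partial>M) = (\<integral>\<omega>. 1 / (Z n \<omega>)\<^sup>2 * I n \<omega> \<partial>M)"
      using Z_hist[OF order_refl] Z2 by (intro orth[symmetric, where B = 1]) auto
    finally show ?thesis by simp
  qed
  have sum_I: "(\<Sum>n<N. I n \<omega> / (Z n \<omega>)\<^sup>2) \<le> 2" if w: "\<omega> \<in> space M" for N \<omega>
  proof -
    let ?B = "\<lambda>n. balls E b C n i \<omega>"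
    have "(\<Sum>n<N. I n \<omega> / (Z n \<omega>)\<^sup>2) \<le> (\<Sum>n<N. (if ?B n < ?B (Suc n) then 1 else 0) / (real (?B n))\<^sup>2)"
    proof (rule sum_mono)
      fix n
      \<comment> \<open>Other edges at \<open>i\<close> may raise the count as well, so the
        indicator is only bounded by that of an increase.\<close>
      have "?B n < ?B (Suc n)" if "C n {i, j} \<omega> = i"
        using that e finite_E by (auto simp: card_gt_0_iff)
      then have "I n \<omega> \<le> (if ?B n < ?B (Suc n) then 1 else 0)"
        by (auto simp: I_def indicator_def simp del: balls.simps)
      then show "I n \<omega> / (Z n \<omega>)\<^sup>2 \<le> (if ?B n < ?B (Suc n) then 1 else 0) / (real (?B n))\<^sup>2"
        unfolding Z_def by (intro divide_right_mono) auto
    qed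
    also have "\<dots> \<le> 2"
      by (rule sum_increase_inverse_square_le) (rule balls_pos[OF iV] balls_mono)+
    finally show ?thesis .
  qed
  have int_I: "integrable M (\<lambda>\<omega>. I n \<omega> / (Z n \<omega>)\<^sup>2)" for n
  proof (rule integrable_real_bounded)
    show "\<bar>I n \<omega> / (Z n \<omega>)\<^sup>2\<bar> \<le> 1" for \<omega>
      using I01[of n \<omega>] one_le_power[OF Z1, of n \<omega> 2] by (simp add: divide_le_eq)
  qed measurable
  have "summable (\<lambda>n. 2 * (\<integral>\<omega>. I n \<omega> / (Z n \<omega>)\<^sup>2 \<partial>M))"
  proof (intro summable_mult bounded_imp_summable)
    show "0 \<le> (\<integral>\<omega>. I n \<omega> / (Z n \<omega>)\<^sup>2 \<partial>M)" for n
      using I01 by (intro integral_nonneg_AE) auto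
    fix N
    have "(\<Sum>n\<le>N. \<integral>\<omega>. I n \<omega> / (Z n \<omega>)\<^sup>2 \<partial>M) = (\<integral>\<omega>. (\<Sum>n<Suc N. I n \<omega> / (Z n \<omega>)\<^sup>2) \<partial>M)"
      using int_I by (simp add: lessThan_Suc_atMost)
    also have "\<dots> \<le> (\<integral>\<omega>. 2 \<partial>M)"
      by (intro integral_mono Bochner_Integration.integrable_sum int_I sum_I) auto
    finally show "(\<Sum>n\<le>N. \<integral>\<omega>. I n \<omega> / (Z n \<omega>)\<^sup>2 \<partial>M) \<le> 2" by (simp add: prob_space)
  qed
  then have "summable (\<lambda>n. \<integral>\<omega>. (d n \<omega>)\<^sup>2 \<partial>M)"
    by (rule summable_comparison_test'[where N = 0]) (use second_moment in simp)
  then have summable_d: "AE \<omega> in M. summable (\<lambda>n. d n \<omega>)" by (rule d.AE_summable)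
  have d_eq: "d n \<omega> = ((if C n {i, j} \<omega> = i then 1 else 0) - choice_rate n i j \<omega>) /
      real (balls E b C n i \<omega>)" if "\<omega> \<in> space M" for n \<omega>
    using that by (simp add: d_def I_def p_def Z_def)
  show ?thesis
    using summable_d AE_space by eventually_elim (simp only: d_eq)
qed

section \<open>Proportions and their logarithmic drift\<close>

abbreviation "total_balls n \<equiv> real (\<Sum>j\<in>V. b j) + real n * real (card E)"

lemma initial_total_pos: "0 < (\<Sum>j\<in>V. b j)"
  using finite_V V_nonempty initial by (intro sum_pos) force+

lemma total_balls_pos: "0 < total_balls n"
  using initial_total_pos by (intro add_pos_nonneg) (auto simp del: of_nat_sum)

lemma proportion_pos: "i \<in> V \<Longrightarrow> 0 < proportion V E b C n i \<omega>"
  unfolding proportion_def using balls_pos total_balls_pos by (intro divide_pos_pos) (auto simp del: of_nat_sum)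

lemma sum_balls:
  assumes "\<omega> \<in> space M"
  shows "(\<Sum>i\<in>V. balls E b C n i \<omega>) = (\<Sum>i\<in>V. b i) + n * card E"
proof (induction n)
  case (Suc n)
  have "(\<Sum>i\<in>V. \<Sum>e\<in>E. if C n e \<omega> = i then 1 else 0) = (\<Sum>e\<in>E. \<Sum>i\<in>V. if C n e \<omega> = i then 1 else 0 :: nat)"
    by (rule sum.swap)
  also have "\<dots> = (\<Sum>e\<in>E. 1)"
    using choice_in[OF assms] edges finite_V by (intro sum.cong) (auto simp: subset_iff)
  finally show ?case
    unfolding balls_increment sum.distrib Suc by simp
qed simp

lemma sum_proportion:
  assumes "\<omega> \<in> space M"
  shows "(\<Sum>i\<in>V. proportion V E b C n i \<omega>) = 1"
proof -
  have "(\<Sum>i\<in>V. real (balls E b C n i \<omega>)) = real (\<Sum>i\<in>V. balls E b C n i \<omega>)" by simp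
  also have "\<dots> = total_balls n" unfolding sum_balls[OF assms] by simp
  finally show ?thesis
    unfolding proportion_def sum_divide_distrib[symmetric] using total_balls_pos[of n] by simp
qed

text \<open>A vertex receiving \<open>D\<close> of the \<open>N\<close> new balls moves by
  \<open>(D - N * x) / total_balls (Suc n)\<close>; with \<open>D\<close> in \<open>[0, N]\<close>
  and \<open>x\<close> in \<open>[0, 1]\<close> this is at most
  \<open>N / total_balls (Suc n)\<close>.\<close>

lemma proportion_step:
  assumes w: "\<omega> \<in> space M" and i: "i \<in> V" and "E \<noteq> {}"
  shows "(\<lambda>n. proportion V E b C (Suc n) i \<omega> - proportion V E b C n i \<omega>) \<longlonglongrightarrow> 0"
proof -
  let ?x = "\<lambda>n. proportion V E b C n i \<omega>"
  let ?N = "real (card E)"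
  have N: "0 < ?N" using finite_E assms(3) by (simp add: card_gt_0_iff)
  have bound: "\<bar>?x (Suc n) - ?x n\<bar> \<le> ?N * (1 / total_balls (Suc n))" for n
  proof -
    have x: "0 \<le> ?x n" "?x n \<le> 1"
      using proportion_pos[OF i] sum_proportion[OF w, of n] finite_V i
        member_le_sum[of i V "\<lambda>i. proportion V E b C n i \<omega>"]
      by (auto intro: less_imp_le proportion_pos)
    define D where "D = real (balls E b C (Suc n) i \<omega>) - real (balls E b C n i \<omega>)"
    have D: "0 \<le> D" "D \<le> ?N"
      using balls_mono[of n i \<omega>] balls_increment_le[of n i \<omega>] unfolding D_def by linarith+
    have "real (balls E b C n i \<omega>) = ?x n * total_balls n"
      unfolding proportion_def using total_balls_pos[of n] by simp
    then have "real (balls E b C (Suc n) i \<omega>) = ?x n * total_balls n + D" by (simp add: D_def)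
    also have "\<dots> = ?x n * total_balls (Suc n) + (D - ?N * ?x n)" by (simp add: algebra_simps)
    finally have "?x (Suc n) = ?x n + (D - ?N * ?x n) / total_balls (Suc n)"
      unfolding proportion_def[of _ _ _ _ "Suc n"] using total_balls_pos[of "Suc n"]
      by (simp add: add_divide_distrib)
    then have "\<bar>?x (Suc n) - ?x n\<bar> = \<bar>D - ?N * ?x n\<bar> / total_balls (Suc n)"
      using total_balls_pos[of "Suc n"] by simp
    also have "\<dots> \<le> ?N / total_balls (Suc n)"
    proof (intro divide_right_mono)
      have "?N * ?x n \<le> ?N" "0 \<le> ?N * ?x n"
        using mult_left_mono[OF x(2), of ?N] x(1) by simp_all
      then show "\<bar>D - ?N * ?x n\<bar> \<le> ?N" using D by simp
    qed (use total_balls_pos[of "Suc n"] in simp)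
    finally show ?thesis by simp
  qed
  have "(\<lambda>n. ?N * (1 / total_balls (Suc n))) \<longlonglongrightarrow> ?N * 0"
    using initial_total_pos N
    by (intro tendsto_mult tendsto_const LIMSEQ_Suc inverse_affine_tendsto) (auto simp del: of_nat_sum)
  then have "(\<lambda>n. ?N * (1 / total_balls (Suc n))) \<longlonglongrightarrow> 0" by simp
  then show ?thesis
    by (rule Lim_null_comparison[rotated]) (use bound in simp)
qed

abbreviation "neighbours i \<equiv> {j. {i, j} \<in> E}"

lemma finite_neighbours: "finite (neighbours i)"
proof (rule finite_subset[OF _ finite_V], rule subsetI)
  fix j assume "j \<in> neighbours i"
  then have "{i, j} \<in> E" by simp
  from edge_in_V[OF this] show "j \<in> V" by simp
qed

lemma balls_increment_neighbours:
  assumes "\<omega> \<in> space M"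
  shows "balls E b C (Suc n) i \<omega> = balls E b C n i \<omega> + (\<Sum>j\<in>neighbours i. if C n {i, j} \<omega> = i then 1 else 0)"
proof -
  have "(\<Sum>e\<in>E. if C n e \<omega> = i then 1 else 0 :: nat) = (\<Sum>e\<in>{e \<in> E. i \<in> e}. if C n e \<omega> = i then 1 else 0)"
    using finite_E choice_in[OF assms] by (intro sum.mono_neutral_right) auto
  also have "{e \<in> E. i \<in> e} = (\<lambda>j. {i, j}) ` neighbours i"
  proof -
    have "\<exists>j. e = {i, j}" if "e \<in> E" "i \<in> e" for e
    proof -
      have "card e = 2" using edges that by blast
      then obtain u v where "e = {u, v}" by (auto simp: card_2_iff)
      then show ?thesis using that by auto
    qed
    then show ?thesis by blast
  qed
  also have "(\<Sum>e\<in>(\<lambda>j. {i, j}) ` neighbours i. if C n e \<omega> = i then 1 else 0 :: nat) =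
      (\<Sum>j\<in>neighbours i. if C n {i, j} \<omega> = i then 1 else 0)"
    by (subst sum.reindex) (auto simp: inj_on_def doubleton_eq_iff)
  finally show ?thesis unfolding balls_increment by simp
qed

text \<open>\<open>ln\<close> of the count follows the sum of relative increments up to a convergent
  error, and each increment splits over the finitely many neighbours into a choice rate and a
  summable noise.\<close>

lemma AE_log_balls_drift:
  assumes i: "i \<in> V"
  shows "AE \<omega> in M. convergent (\<lambda>n. ln (real (balls E b C n i \<omega>)) -
    (\<Sum>t<n. \<Sum>j\<in>neighbours i. choice_rate t i j \<omega> / real (balls E b C t i \<omega>)))"
proof -
  have "AE \<omega> in M. \<forall>j\<in>neighbours i. summable (\<lambda>n. ((if C n {i, j} \<omega> = i then 1 else 0) -
      choice_rate n i j \<omega>) / real (balls E b C n i \<omega>))"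
    using finite_neighbours AE_summable_choice_noise by (intro AE_finite_allI) auto
  then show ?thesis
  proof (rule AE_mp, intro AE_I2 impI)
    fix \<omega>
    let ?B = "\<lambda>n. balls E b C n i \<omega>"
    let ?d = "\<lambda>n j. ((if C n {i, j} \<omega> = i then 1 else 0) - choice_rate n i j \<omega>) / real (?B n)"
    let ?R = "\<lambda>n. \<Sum>j\<in>neighbours i. choice_rate n i j \<omega> / real (?B n)"
    assume w: "\<omega> \<in> space M" and "\<forall>j\<in>neighbours i. summable (\<lambda>n. ?d n j)"
    then have "summable (\<lambda>n. \<Sum>j\<in>neighbours i. ?d n j)" by (intro summable_sum) auto
    then have "convergent (\<lambda>n. \<Sum>t<n. \<Sum>j\<in>neighbours i. ?d t j)"
      by (simp add: summable_iff_convergent)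
    moreover have "convergent (\<lambda>n. ln (real (?B n)) - (\<Sum>t<n. (real (?B (Suc t)) - real (?B t)) / real (?B t)))"
      by (rule convergent_ln_minus_relative_increments[where K = "card E"])
        (rule balls_pos[OF i] balls_mono balls_increment_le)+
    ultimately have "convergent (\<lambda>n. ln (real (?B n)) - (\<Sum>t<n. (real (?B (Suc t)) - real (?B t)) / real (?B t)) +
        (\<Sum>t<n. \<Sum>j\<in>neighbours i. ?d t j))"
      by (intro convergent_add)
    moreover have "(real (?B (Suc t)) - real (?B t)) / real (?B t) = (\<Sum>j\<in>neighbours i. ?d t j) + ?R t" for t
    proof -
      have "real (?B (Suc t)) - real (?B t) = (\<Sum>j\<in>neighbours i. if C t {i, j} \<omega> = i then 1 else 0)"
        unfolding balls_increment_neighbours[OF w]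
        by (simp only: of_nat_add of_nat_sum if_distrib[of real] of_nat_1 of_nat_0 add_diff_cancel_left')
      then show ?thesis
        by (simp add: sum_divide_distrib diff_divide_distrib sum_subtractf del: balls.simps)
    qed
    ultimately show "convergent (\<lambda>n. ln (real (?B n)) - (\<Sum>t<n. ?R t))"
      by (simp add: sum.distrib del: balls.simps)
  qed
qed

lemma AE_log_proportion_drift:
  assumes i: "i \<in> V"
  shows "AE \<omega> in M. convergent (\<lambda>n. ln (proportion V E b C n i \<omega>) -
    (\<Sum>t<n. 1 / total_balls t * ((\<Sum>j\<in>neighbours i.
      1 / load \<alpha> (proportion V E b C t i \<omega>) (proportion V E b C t j \<omega>)) - real (card E))))"
  using AE_log_balls_drift[OF i]
proof (rule AE_mp, intro AE_I2 impI)
  fix \<omega>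
  let ?x = "\<lambda>t i. proportion V E b C t i \<omega>" and ?B = "\<lambda>t i. balls E b C t i \<omega>"
  let ?R = "\<lambda>t. \<Sum>j\<in>neighbours i. choice_rate t i j \<omega> / real (?B t i)"
  assume w: "\<omega> \<in> space M" and c: "convergent (\<lambda>n. ln (real (?B n i)) - (\<Sum>t<n. ?R t))"
  \<comment> \<open>The total is itself an increasing integer sequence with bounded steps, so its
    logarithm has the same kind of expansion. Subtracting it produces the term
    \<open>- card E\<close>.\<close>
  let ?S = "\<lambda>n. (\<Sum>j\<in>V. b j) + n * card E"
  have S: "real (?S n) = total_balls n" for n by simp
  have "convergent (\<lambda>n. ln (real (?S n)) - (\<Sum>t<n. (real (?S (Suc t)) - real (?S t)) / real (?S t)))"
    using initial_total_pos by (intro convergent_ln_minus_relative_increments[where K = "card E"]) auto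
  then have "convergent (\<lambda>n. ln (total_balls n) - (\<Sum>t<n. real (card E) / total_balls t))"
    unfolding S by (simp add: algebra_simps)
  with c have "convergent (\<lambda>n. (ln (real (?B n i)) - (\<Sum>t<n. ?R t)) -
      (ln (total_balls n) - (\<Sum>t<n. real (card E) / total_balls t)))"
    by (rule convergent_diff)
  moreover have "(ln (real (?B n i)) - (\<Sum>t<n. ?R t)) -
      (ln (total_balls n) - (\<Sum>t<n. real (card E) / total_balls t)) =
      ln (?x n i) - (\<Sum>t<n. 1 / total_balls t * ((\<Sum>j\<in>neighbours i. 1 / load \<alpha> (?x t i) (?x t j)) - real (card E)))" for n
  proof -
    have "ln (?x n i) = ln (real (?B n i)) - ln (total_balls n)"
      unfolding proportion_def using balls_pos[OF i, of n \<omega>] total_balls_pos[of n]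
      by (intro ln_divide_pos) (auto simp del: of_nat_sum)
    moreover have "?R t = 1 / total_balls t * (\<Sum>j\<in>neighbours i. 1 / load \<alpha> (?x t i) (?x t j))" for t
      unfolding sum_distrib_left
    proof (rule sum.cong[OF refl])
      fix j assume "j \<in> neighbours i"
      then have "{i, j} \<in> E" by simp
      from edge_in_V[OF this] have j: "j \<in> V" by simp
      have "choice_rate t i j \<omega> / real (?B t i) = 1 / load \<alpha> (real (?B t i)) (real (?B t j))"
        unfolding choice_rate_def using balls_pos[OF i, of t \<omega>] balls_pos[OF j, of t \<omega>]
        by (intro inverse_load[symmetric]) auto
      also have "load \<alpha> (real (?B t i)) (real (?B t j)) = load \<alpha> (total_balls t * ?x t i) (total_balls t * ?x t j)"
        unfolding proportion_def using total_balls_pos[of t] by simp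
      also have "\<dots> = total_balls t * load \<alpha> (?x t i) (?x t j)"
        using total_balls_pos[of t] proportion_pos[OF i, of t \<omega>] proportion_pos[OF j, of t \<omega>]
        by (intro load_scale) auto
      finally show "choice_rate t i j \<omega> / real (?B t i) = 1 / total_balls t * (1 / load \<alpha> (?x t i) (?x t j))"
        by simp
    qed
    ultimately show ?thesis
      by (simp add: right_diff_distrib sum_subtractf del: of_nat_sum)
  qed
  ultimately show "convergent (\<lambda>n. ln (?x n i) - (\<Sum>t<n. 1 / total_balls t *
      ((\<Sum>j\<in>neighbours i. 1 / load \<alpha> (?x t i) (?x t j)) - real (card E))))" by simp
qed

lemma proportion_measurable [measurable]: "(\<lambda>\<omega>. proportion V E b C n i \<omega>) \<in> borel_measurable M"
  unfolding proportion_def by measurable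

section \<open>One-sided choices forever when \<alpha> > 1\<close>

lemma balls_eq_of_choices:
  assumes "\<And>t e. t < n \<Longrightarrow> e \<in> E \<Longrightarrow> C t e \<omega> = s e"
  shows "balls E b C n i \<omega> = b i + n * card {e \<in> E. s e = i}"
  using assms
proof (induction n)
  case (Suc n)
  have "{e \<in> E. C n e \<omega> = i} = {e \<in> E. s e = i}" using Suc.prems[of n] by auto
  then show ?case using Suc by simp
qed simp

text \<open>The hypotheses say that the vertices \<open>s e\<close> form one side of a bipartition of the graph.\<close>

lemma prob_choices_pos:
  assumes s: "\<And>e. e \<in> E \<Longrightarrow> s e \<in> e"
    and side: "\<And>e e'. e \<in> E \<Longrightarrow> e' \<in> E \<Longrightarrow> s e' \<in> e \<Longrightarrow> s e' = s e"
    and "\<alpha> > 1"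
  shows "prob {\<omega> \<in> space M. \<forall>t. \<forall>e\<in>E. C t e \<omega> = s e} > 0"
proof -
  define A where "A n = {\<omega> \<in> space M. \<forall>t<n. \<forall>e\<in>E. C t e \<omega> = s e}" for n
  define N where "N n = {\<omega> \<in> space M. \<forall>e\<in>E. C n e \<omega> = s e}" for n
  define D where "D = real (\<Sum>i\<in>V. b i)"
  \<comment> \<open>On \<open>A n\<close> the preferred endpoint holds \<open>u \<ge> n + 1\<close>
    balls and the other one \<open>v \<le> D\<close>. The favourable probability is
    \<open>1 / (1 + (v / u) powr \<alpha>)\<close>, and \<open>1 + y \<le> exp y\<close> bounds it
    below by \<open>q n\<close>. The exponential form turns later products into sums.\<close>
  define q where "q n = exp (- ((D / real (Suc n)) powr \<alpha>))" for n
  have D: "real (b i) \<le> D" if "i \<in> V" for i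
    unfolding D_def of_nat_le_iff using member_le_sum[OF that _ finite_V, of b] by simp
  have N_history: "N t \<in> sets (history M E C n)" if "t < n" for t n
  proof -
    have "{\<omega> \<in> space (history M E C n). \<forall>e\<in>E. C t e \<omega> = s e} \<in> sets (history M E C n)"
      using choice_history[OF that] by (intro sets.sets_Collect_finite_All finite_E) simp
    then show ?thesis by (simp add: N_def)
  qed
  have A_eq: "A n = {\<omega> \<in> space (history M E C n). \<forall>t\<in>{..<n}. \<omega> \<in> N t}" for n
    by (auto simp: A_def N_def)
  have A_history: "A n \<in> sets (history M E C n)" for n
    unfolding A_eq
  proof (intro sets.sets_Collect_finite_All)
    fix t assume t: "t \<in> {..<n}"
    have "{\<omega> \<in> space (history M E C n). \<omega> \<in> N t} = N t" by (auto simp: N_def)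
    then show "{\<omega> \<in> space (history M E C n). \<omega> \<in> N t} \<in> sets (history M E C n)"
      using N_history t by simp
  qed simp
  have hist_M: "X \<in> events" if "X \<in> sets (history M E C n)" for X n
    using that subalgebra_history by (auto simp: subalgebra_def)
  have A_events: "A n \<in> events" and N_events: "N n \<in> events" for n
    using hist_M[OF A_history] hist_M[OF N_history[OF lessI]] by auto
  have A_Suc: "A (Suc n) = A n \<inter> N n" for n
    by (auto simp: A_def N_def less_Suc_eq)
  have edge_bound: "AE \<omega> in M. \<omega> \<in> A n \<longrightarrow> q n \<le> cond_prob_history M E C n {\<omega> \<in> space M. C n e \<omega> = s e} \<omega>"
    if e: "e \<in> E" for n e
  proof -
    obtain o' where o: "e = {s e, o'}" "s e \<noteq> o'"
      using edges[OF e] s[OF e] by (auto simp: card_2_iff doubleton_eq_iff)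
    then have "{s e, o'} \<in> E" using e by simp
    note V = edge_in_V[OF this]
    have "AE \<omega> in M. cond_prob_history M E C n {\<omega> \<in> space M. C n {s e, o'} \<omega> = s e} \<omega> = choice_rate n (s e) o' \<omega>"
      unfolding choice_rate_def using \<open>{s e, o'} \<in> E\<close> by (rule choice_prob)
    then show ?thesis
      unfolding o(1)[symmetric]
    proof (rule AE_mp, intro AE_I2 impI)
      fix \<omega>
      assume c: "cond_prob_history M E C n {\<omega> \<in> space M. C n e \<omega> = s e} \<omega> = choice_rate n (s e) o' \<omega>"
        and "\<omega> \<in> A n"
      then have balls: "balls E b C n i \<omega> = b i + n * card {e \<in> E. s e = i}" for i
        by (intro balls_eq_of_choices) (auto simp: A_def)
      have "1 \<le> card {e' \<in> E. s e' = s e}"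
        using e finite_E by (simp add: Suc_le_eq card_gt_0_iff) blast
      then have "n * 1 \<le> n * card {e' \<in> E. s e' = s e}" by (intro mult_le_mono2)
      then have u: "Suc n \<le> balls E b C n (s e) \<omega>"
        using initial[OF conjunct1[OF V]] unfolding balls[of "s e"] by linarith
      \<comment> \<open>If some edge preferred \<open>o'\<close>, the bipartition hypothesis would
        force \<open>o' = s e\<close>. So \<open>o'\<close> never gains a ball on
        \<open>A n\<close>, while \<open>s e\<close> gains at least one per step from
        \<open>e\<close>.\<close>
      have "{e' \<in> E. s e' = o'} = {}"
      proof safe
        fix e' assume e': "e' \<in> E" "o' = s e'"
        then have "s e' \<in> e" using o(1) by (metis insertCI)
        then show "e' \<in> {}" using side[OF e e'(1)] o(2) e'(2) by simp
      qed
      then have v: "balls E b C n o' \<omega> = b o'"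
        unfolding balls[of o'] by (simp only: card.empty mult_0_right add_0_right)
      define u' v' where "u' = real (balls E b C n (s e) \<omega>)" and "v' = real (b o')"
      have uv: "0 < u'" "real (Suc n) \<le> u'" "0 < v'" "v' \<le> D"
        using u D[of o'] V initial[of o'] unfolding u'_def v'_def by (auto simp del: balls.simps)
      have "q n \<le> exp (- ((v' / u') powr \<alpha>))"
        unfolding q_def using uv alpha_pos by (auto intro!: powr_mono2 frac_le)
      also have "\<dots> = 1 / exp ((v' / u') powr \<alpha>)" by (simp add: exp_minus inverse_eq_divide)
      also have "\<dots> \<le> 1 / (1 + (v' / u') powr \<alpha>)"
        by (intro divide_left_mono exp_ge_add_one_self mult_pos_pos) (auto intro: add_pos_nonneg)
      also have "\<dots> = u' powr \<alpha> / (u' powr \<alpha> + v' powr \<alpha>)"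
      proof -
        have "1 / (1 + y / x) = x / (x + y)" if "0 < x" "0 < y" for x y :: real
          using that by (simp add: field_simps)
        then show ?thesis using uv by (simp add: powr_divide)
      qed
      also have "\<dots> = choice_rate n (s e) o' \<omega>"
        by (simp add: choice_rate_def v u'_def v'_def)
      finally show "q n \<le> cond_prob_history M E C n {\<omega> \<in> space M. C n e \<omega> = s e} \<omega>"
        using c by simp
    qed
  qed
  \<comment> \<open>\<open>A n\<close> belongs to the history, so the probability of
    \<open>A (Suc n)\<close> is the integral over \<open>A n\<close> of the conditional probability
    of \<open>N n\<close>, which factorises over the edges by \<open>choice_indep\<close>.\<close>
  have step: "prob (A n) * q n ^ card E \<le> prob (A (Suc n))" for n
  proof -
    interpret h: sigma_finite_subalgebra M "history M E C n" by (rule sigma_finite_history)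
    have int: "integrable M (\<lambda>\<omega>. indicat_real (A n) \<omega> * indicat_real (N n) \<omega>)"
      using A_events N_events by (intro integrable_real_bounded[of _ 1]) (auto simp: indicator_def)
    have int_A: "integrable M (\<lambda>\<omega>. indicat_real (A n) \<omega> * q n ^ card E)"
      using A_events by (intro integrable_mult_left integrable_real_bounded[of _ 1]) (auto simp: indicator_def)
    have cond: "AE \<omega> in M. indicat_real (A n) \<omega> * q n ^ card E \<le>
        indicat_real (A n) \<omega> * cond_prob_history M E C n (N n) \<omega>"
    proof -
      have "AE \<omega> in M. cond_prob_history M E C n (N n) \<omega> =
          (\<Prod>e\<in>E. cond_prob_history M E C n {\<omega> \<in> space M. C n e \<omega> = s e} \<omega>)"
        unfolding N_def by (rule choice_indep) simp
      moreover have "AE \<omega> in M. \<forall>e\<in>E. \<omega> \<in> A n \<longrightarrow>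
          q n \<le> cond_prob_history M E C n {\<omega> \<in> space M. C n e \<omega> = s e} \<omega>"
        using edge_bound by (intro AE_finite_allI finite_E)
      ultimately show ?thesis
      proof eventually_elim
        case (elim \<omega>)
        show ?case
        proof (cases "\<omega> \<in> A n")
          case True
          have "(\<Prod>e\<in>E. q n) \<le> (\<Prod>e\<in>E. cond_prob_history M E C n {\<omega> \<in> space M. C n e \<omega> = s e} \<omega>)"
            using elim True by (intro prod_mono) (auto simp: q_def)
          then show ?thesis using elim True by simp
        qed simp
      qed
    qed
    have "prob (A n) * q n ^ card E = (\<integral>\<omega>. indicat_real (A n) \<omega> * q n ^ card E \<partial>M)"
      using A_events sets.sets_into_space[OF A_events] by (simp add: Int_absorb2)
    also have "\<dots> \<le> (\<integral>\<omega>. indicat_real (A n) \<omega> * cond_prob_history M E C n (N n) \<omega> \<partial>M)"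
      using A_events A_history N_events
      by (intro integral_mono_AE cond h.real_cond_exp_intg(1) int int_A) auto
    also have "\<dots> = (\<integral>\<omega>. indicat_real (A n) \<omega> * indicat_real (N n) \<omega> \<partial>M)"
      using A_history N_events by (intro h.real_cond_exp_intg(2) int) auto
    also have "\<dots> = (\<integral>\<omega>. indicat_real (A (Suc n)) \<omega> \<partial>M)"
      unfolding A_Suc by (intro Bochner_Integration.integral_cong) (auto simp: indicator_def)
    also have "\<dots> = prob (A (Suc n))"
      using sets.sets_into_space[OF A_events] by (simp add: Int_absorb2)
    finally show ?thesis .
  qed
  \<comment> \<open>The exponent in \<open>q n ^ card E = exp (- c n)\<close>. It is of order
    \<open>n powr (- \<alpha>)\<close>, hence summable for \<alpha> > 1, and
    \<open>exp (- suminf c)\<close> is a positive lower bound uniform in \<open>n\<close>.\<close>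
  define c where "c n = real (card E) * (D / real (Suc n)) powr \<alpha>" for n
  have "summable (\<lambda>n. real (Suc n) powr (- \<alpha>))"
    using \<open>\<alpha> > 1\<close> by (subst summable_Suc_iff[of "\<lambda>n. real n powr (- \<alpha>)"]) (simp add: summable_real_powr_iff)
  then have summable_rate: "summable (\<lambda>n. real (card E) * D powr \<alpha> * real (Suc n) powr (- \<alpha>))"
    by (rule summable_mult)
  have "c n = real (card E) * D powr \<alpha> * real (Suc n) powr (- \<alpha>)" for n
  proof -
    have "0 \<le> D" unfolding D_def by (rule of_nat_0_le_iff)
    then show ?thesis unfolding c_def by (simp add: powr_divide powr_minus_divide)
  qed
  then have c_eq: "c = (\<lambda>n. real (card E) * D powr \<alpha> * real (Suc n) powr (- \<alpha>))" by (rule ext)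
  have c: "summable c" unfolding c_eq by (rule summable_rate)
  have c_nonneg: "0 \<le> c n" for n by (simp add: c_def)
  have prob_A: "exp (- (\<Sum>t<n. c t)) \<le> prob (A n)" for n
  proof (induction n)
    case 0
    then show ?case by (simp add: A_def prob_space)
  next
    case (Suc n)
    have "exp (- (\<Sum>t<Suc n. c t)) = exp (- (\<Sum>t<n. c t)) * q n ^ card E"
      by (simp add: q_def c_def exp_of_nat_mult[symmetric] exp_add[symmetric])
    also have "\<dots> \<le> prob (A n) * q n ^ card E"
      using Suc by (intro mult_right_mono) (auto simp: q_def)
    also have "\<dots> \<le> prob (A (Suc n))" by (rule step)
    finally show ?case .
  qed
  have "(\<lambda>n. prob (A n)) \<longlonglongrightarrow> prob (\<Inter>n. A n)"
  proof (rule finite_Lim_measure_decseq)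
    show "range A \<subseteq> events" using A_events by blast
    show "decseq A" by (rule decseq_SucI) (simp add: A_Suc)
  qed
  moreover have "exp (- (\<Sum>t. c t)) \<le> prob (A n)" for n
    using prob_A[of n] sum_le_suminf[OF c, of "{..<n}"] c_nonneg
    by (intro order_trans[OF _ prob_A]) auto
  ultimately have "exp (- (\<Sum>t. c t)) \<le> prob (\<Inter>n. A n)"
    by (intro LIMSEQ_le_const) auto
  moreover have "(\<Inter>n. A n) = {\<omega> \<in> space M. \<forall>t. \<forall>e\<in>E. C t e \<omega> = s e}"
    unfolding A_def by auto
  ultimately show ?thesis by (metis exp_gt_zero less_le_trans)
qed

text \<open>On the event of the previous lemma every ball count is affine in the number of steps, so
  its proportion tends to the fraction of edges that prefer the vertex.\<close>

lemma prob_limit_pos: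
  assumes s: "\<And>e. e \<in> E \<Longrightarrow> s e \<in> e"
    and side: "\<And>e e'. e \<in> E \<Longrightarrow> e' \<in> E \<Longrightarrow> s e' \<in> e \<Longrightarrow> s e' = s e"
    and "\<alpha> > 1" "E \<noteq> {}"
  shows "prob {\<omega> \<in> space M. \<forall>i\<in>V. (\<lambda>n. proportion V E b C n i \<omega>) \<longlonglongrightarrow>
    real (card {e \<in> E. s e = i}) / real (card E)} > 0"
proof -
  let ?L = "{\<omega> \<in> space M. \<forall>i\<in>V. (\<lambda>n. proportion V E b C n i \<omega>) \<longlonglongrightarrow>
    real (card {e \<in> E. s e = i}) / real (card E)}"
  have "?L \<in> events"
    using finite_V by (intro sets.sets_Collect_finite_All measurable_tendsto_const) auto
  moreover have "{\<omega> \<in> space M. \<forall>t. \<forall>e\<in>E. C t e \<omega> = s e} \<subseteq> ?L"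
  proof safe
    fix \<omega> i assume "\<forall>t. \<forall>e\<in>E. C t e \<omega> = s e" "i \<in> V"
    then have "balls E b C n i \<omega> = b i + n * card {e \<in> E. s e = i}" for n
      by (intro balls_eq_of_choices) auto
    then show "(\<lambda>n. proportion V E b C n i \<omega>) \<longlonglongrightarrow> real (card {e \<in> E. s e = i}) / real (card E)"
      unfolding proportion_def
      using affine_ratio_tendsto[of "real (\<Sum>j\<in>V. b j)" "real (card E)" "real (b i)" "real (card {e \<in> E. s e = i})"]
        initial_total_pos finite_E \<open>E \<noteq> {}\<close> by (simp add: card_gt_0_iff del: of_nat_sum)
  qed
  ultimately show ?thesis
    using prob_choices_pos[OF s side \<open>\<alpha> > 1\<close>] finite_measure_mono by (meson less_le_trans)
qed

end

section \<open>Specialisation to the star\<close>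

lemma card_star_edges: "card (star_edges m) = m - 1"
proof -
  have "star_edges m = (\<lambda>i. {i, m}) ` {1..m-1}" by (auto simp: star_edges_def)
  moreover have "inj_on (\<lambda>i. {i, m}) {1..m-1}" by (auto simp: inj_on_def doubleton_eq_iff)
  ultimately show ?thesis by (simp add: card_image)
qed

lemma edge_in_star_edges:
  "{i, j} \<in> star_edges m \<longleftrightarrow> (j = m \<and> i \<in> {1..m-1}) \<or> (i = m \<and> j \<in> {1..m-1})"
  by (auto simp: star_edges_def doubleton_eq_iff)

theorem theorem1p5:
  fixes M :: "'w measure" and m :: nat and \<alpha> :: real
    and b :: "nat \<Rightarrow> nat" and C :: "nat \<Rightarrow> nat set \<Rightarrow> 'w \<Rightarrow> nat"
  assumes "m \<ge> 3"
    and "polya_urn M {1..m} (star_edges m) \<alpha> b C"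
  defines "x \<equiv> proportion {1..m} (star_edges m) b C"
  shows "(\<alpha> \<le> 1 \<longrightarrow>
            (AE \<omega> in M. \<forall>i\<in>{1..m}. (\<lambda>n. x n i \<omega>) \<longlonglongrightarrow> star_limit m \<alpha> i)) \<and>
         (\<alpha> > 1 \<longrightarrow>
            measure M {\<omega> \<in> space M. \<forall>i\<in>{1..m}.
              (\<lambda>n. x n i \<omega>) \<longlonglongrightarrow> (if i = m then 1 else 0)} > 0 \<and>
            measure M {\<omega> \<in> space M. \<forall>i\<in>{1..m}.
              (\<lambda>n. x n i \<omega>) \<longlonglongrightarrow> (if i = m then 0 else 1 / (real m - 1))} > 0)"
proof -
  interpret polya_urn M "{1..m}" "star_edges m" \<alpha> b C by (rule assms(2))
  let ?A = "{1..m-1}"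
  have E: "star_edges m \<noteq> {}" "real (card (star_edges m)) = real m - 1"
    using \<open>m \<ge> 3\<close> card_star_edges[of m] by (auto simp: of_nat_diff)
  have V: "{1..m} = insert m ?A" using \<open>m \<ge> 3\<close> by auto
  have card_A: "real (card ?A) = real m - 1" using \<open>m \<ge> 3\<close> by (simp add: of_nat_diff)
  have hub_neighbours: "neighbours m = ?A"
    using \<open>m \<ge> 3\<close> by (auto simp: edge_in_star_edges)
  have leaf_neighbours: "neighbours i = {m}" if "i \<in> ?A" for i
    using that \<open>m \<ge> 3\<close> by (auto simp: edge_in_star_edges)
  have "AE \<omega> in M. \<forall>i\<in>{1..m}. (\<lambda>n. x n i \<omega>) \<longlonglongrightarrow> star_limit m \<alpha> i" if "\<alpha> \<le> 1"
  proof -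
    have "AE \<omega> in M. \<forall>i\<in>{1..m}. convergent (\<lambda>n. ln (x n i \<omega>) -
        (\<Sum>t<n. 1 / total_balls t * ((\<Sum>j\<in>neighbours i. 1 / load \<alpha> (x t i \<omega>) (x t j \<omega>)) -
          real (card (star_edges m)))))"
      unfolding x_def using AE_log_proportion_drift by (intro AE_finite_allI) auto
    then show ?thesis
    proof (rule AE_mp, intro AE_I2 impI)
      fix \<omega>
      assume w: "\<omega> \<in> space M" and drift: "\<forall>i\<in>{1..m}. convergent (\<lambda>n. ln (x n i \<omega>) -
        (\<Sum>t<n. 1 / total_balls t * ((\<Sum>j\<in>neighbours i. 1 / load \<alpha> (x t i \<omega>) (x t j \<omega>)) -
          real (card (star_edges m)))))"
      interpret s: star_dynamics ?A "\<lambda>n i. x n i \<omega>" "\<lambda>n. x n m \<omega>" "\<lambda>n. 1 / total_balls n" \<alpha>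
      proof
        show "0 < x n i \<omega>" if "i \<in> ?A" for n i
          unfolding x_def using that V by (intro proportion_pos) auto
        show "0 < x n m \<omega>" for n
          unfolding x_def using V by (intro proportion_pos) auto
        show "(\<Sum>i\<in>?A. x n i \<omega>) + x n m \<omega> = 1" for n
        proof -
          have "(\<Sum>i\<in>{1..m}. f i) = (\<Sum>i\<in>?A. f i) + f m" for f :: "nat \<Rightarrow> real"
            unfolding V using \<open>m \<ge> 3\<close> by simp
          then show ?thesis using sum_proportion[OF w, of n] by (simp only: x_def)
        qed
        show "0 \<le> 1 / total_balls n" for n
          using total_balls_pos[of n] by simp
        show "\<not> summable (\<lambda>n. 1 / total_balls n)"
          using initial_total_pos E(2) \<open>m \<ge> 3\<close>
          by (intro inverse_affine_not_summable) (auto simp del: of_nat_sum)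
        show "(\<lambda>n. x (Suc n) i \<omega> - x n i \<omega>) \<longlonglongrightarrow> 0" if "i \<in> ?A" for i
          unfolding x_def using that V E(1) by (intro proportion_step w) auto
        show "(\<lambda>n. x (Suc n) m \<omega> - x n m \<omega>) \<longlonglongrightarrow> 0"
          unfolding x_def using V E(1) by (intro proportion_step w) auto
        show "convergent (\<lambda>n. ln (x n i \<omega>) -
            (\<Sum>j<n. 1 / total_balls j * (1 / load \<alpha> (x j i \<omega>) (x j m \<omega>) - real (card ?A))))"
          if "i \<in> ?A" for i
        proof -
          have "i \<in> {1..m}" using that by auto
          from bspec[OF drift this] show ?thesis
            unfolding leaf_neighbours[OF that] E(2) card_A by simp
        qed
        show "convergent (\<lambda>n. ln (x n m \<omega>) -
            (\<Sum>j<n. 1 / total_balls j * ((\<Sum>i\<in>?A. 1 / load \<alpha> (x j m \<omega>) (x j i \<omega>)) - real (card ?A))))"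
        proof -
          have "m \<in> {1..m}" using \<open>m \<ge> 3\<close> by simp
          from bspec[OF drift this] show ?thesis
            unfolding hub_neighbours E(2) card_A by simp
        qed
      qed (use \<open>m \<ge> 3\<close> alpha_pos \<open>\<alpha> \<le> 1\<close> in auto)
      show "\<forall>i\<in>{1..m}. (\<lambda>n. x n i \<omega>) \<longlonglongrightarrow> star_limit m \<alpha> i"
      proof (cases "\<alpha> = 1")
        case True
        then show ?thesis using s.linear_limits V by (auto simp: star_limit_def)
      next
        case False
        then have "\<alpha> < 1" using \<open>\<alpha> \<le> 1\<close> by simp
        then show ?thesis
          using s.sublinear_hub_limit s.sublinear_leaf_limit unfolding card_A V
          by (auto simp: star_limit_def)
      qed
    qed
  qed
  moreover have "prob {\<omega> \<in> space M. \<forall>i\<in>{1..m}. (\<lambda>n. x n i \<omega>) \<longlonglongrightarrow> (if i = m then 1 else 0)} > 0 \<and>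
      prob {\<omega> \<in> space M. \<forall>i\<in>{1..m}. (\<lambda>n. x n i \<omega>) \<longlonglongrightarrow> (if i = m then 0 else 1 / (real m - 1))} > 0"
    if "\<alpha> > 1"
  proof
    \<comment> \<open>The hub carries the largest label, so \<open>Max\<close> selects the hub of
      every edge and \<open>Min\<close> its leaf. These are the two sides of the bipartition, and
      each gives one of the two limits.\<close>
    have Max: "Max e = m" "m \<in> e" and Min: "Min e \<in> ?A" "e = {Min e, m}"
      if e: "e \<in> star_edges m" for e
    proof -
      obtain i where "i \<in> ?A" "e = {i, m}" using e by (auto simp: star_edges_def)
      moreover from this have "Max {i, m} = m" "Min {i, m} = i" by auto
      ultimately show "Max e = m" "m \<in> e" "Min e \<in> ?A" "e = {Min e, m}" by simp_all
    qed
    have "{e \<in> star_edges m. Max e = i} = (if i = m then star_edges m else {})" for i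
      using Max by auto
    then have "real (card {e \<in> star_edges m. Max e = i}) / real (card (star_edges m)) = (if i = m then 1 else 0)" for i
      using E \<open>m \<ge> 3\<close> by simp
    then show "prob {\<omega> \<in> space M. \<forall>i\<in>{1..m}. (\<lambda>n. x n i \<omega>) \<longlonglongrightarrow> (if i = m then 1 else 0)} > 0"
      using prob_limit_pos[of Max, OF _ _ that E(1)] Max unfolding x_def by simp
    have "{e \<in> star_edges m. Min e = i} = (if i = m then {} else {{i, m}})" if i: "i \<in> {1..m}" for i
    proof (cases "i = m")
      case True
      then show ?thesis using Min(1) \<open>m \<ge> 3\<close> by fastforce
    next
      case False
      then have "i \<in> ?A" using i by auto
      then have "{i, m} \<in> star_edges m" "Min {i, m} = i" by (auto simp: star_edges_def)
      then show ?thesis using False Min(2) by auto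
    qed
    then have ratio: "real (card {e \<in> star_edges m. Min e = i}) / real (card (star_edges m)) =
        (if i = m then 0 else 1 / (real m - 1))" if "i \<in> {1..m}" for i
      using E that by simp
    have "prob {\<omega> \<in> space M. \<forall>i\<in>{1..m}. (\<lambda>n. x n i \<omega>) \<longlonglongrightarrow>
        real (card {e \<in> star_edges m. Min e = i}) / real (card (star_edges m))} > 0"
      unfolding x_def
    proof (rule prob_limit_pos[OF _ _ that E(1)])
      fix e e' assume e: "e \<in> star_edges m"
      then show "Min e \<in> e" using Min(2) by blast
      assume e': "e' \<in> star_edges m" and "Min e' \<in> e"
      then have "Min e' \<in> {Min e, m}" using Min(2)[OF e] by blast
      then show "Min e' = Min e" using Min(1)[OF e'] \<open>m \<ge> 3\<close> by auto
    qed
    then show "prob {\<omega> \<in> space M. \<forall>i\<in>{1..m}. (\<lambda>n. x n i \<omega>) \<longlonglongrightarrow> (if i = m then 0 else 1 / (real m - 1))} > 0"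
    proof -
      have "(\<forall>i\<in>{1..m}. (\<lambda>n. x n i \<omega>) \<longlonglongrightarrow> real (card {e \<in> star_edges m. Min e = i}) / real (card (star_edges m))) \<longleftrightarrow>
          (\<forall>i\<in>{1..m}. (\<lambda>n. x n i \<omega>) \<longlonglongrightarrow> (if i = m then 0 else 1 / (real m - 1)))" for \<omega>
        by (intro ball_cong refl) (simp only: ratio)
      then show "prob {\<omega> \<in> space M. \<forall>i\<in>{1..m}. (\<lambda>n. x n i \<omega>) \<longlonglongrightarrow>
          real (card {e \<in> star_edges m. Min e = i}) / real (card (star_edges m))} > 0 \<Longrightarrow> ?thesis"
        by (simp only:)
    qed
  qed
  ultimately show ?thesis by blast
qed

end
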